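(* Let $G$ be a graph. The following are equivalent: 1) $G$ is $7$--ac; 2) $G$ is $\omega$--ac; 3) $G$ is the continuous injective image of a sub-interval of the real line; 4) $G$ is (homeomorphic to) one of the following graphs: the arc, the simple closed curve, the figure eight curve, the lollipop, the dumbbell or the theta curve.
   Context: A graph is a connected space obtained by taking a finite (nonempty) family of arcs and then identifying some of the endpoints. An arc is a space homeomorphic to $[0,1]$. A topological space $X$ is $n$--arc connected ($n$--ac) if for any points $p_1,\dots,p_n$ in $X$ there exists an arc $\alpha$ in $X$ (a subspace homeomorphic to $[0,1]$) with $p_1,\dots,p_n\in\alpha$. $X$ is $\omega$--ac if it is $n$--ac for all $n\in\mathbb{N}$. The figure eight curve is two simple closed curves meeting in exactly one point; the lollipop is a simple closed curve together with an arc meeting it in exactly one endpoint of the arc; the dumbbell is two disjoint simple closed curves together with an arc meeting each of them in exactly one point, those two points being the two endpoints of the arc; the theta curve is three arcs with the same two endpoints which are otherwise pairwise disjoint. Sub-intervals of the real line may be open, closed or half-open, bounded or unbounded. *)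

theory Defs
  imports "HOL-Analysis.Analysis" "HOL-Analysis.Sum_Topology"
begin

abbreviation unit_interval_topology :: "real topology" where
  "unit_interval_topology \<equiv> top_of_set {0..1}"

(* The containment in topspace is needed because
   subtopology X A = subtopology X (topspace X \<inter> A). *)
definition arc_in :: "'a topology \<Rightarrow> 'a set \<Rightarrow> bool" where
  "arc_in X A \<longleftrightarrow> A \<subseteq> topspace X \<and> subtopology X A homeomorphic_space unit_interval_topology"

definition arc_in_with_ends :: "'a topology \<Rightarrow> 'a set \<Rightarrow> 'a \<Rightarrow> 'a \<Rightarrow> bool" where
  "arc_in_with_ends X A a b \<longleftrightarrow>
     A \<subseteq> topspace X \<and>
     (\<exists>h. homeomorphic_map unit_interval_topology (subtopology X A) h \<and> h 0 = a \<and> h 1 = b)"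

definition simple_closed_curve_in :: "'a topology \<Rightarrow> 'a set \<Rightarrow> bool" where
  "simple_closed_curve_in X S \<longleftrightarrow>
     S \<subseteq> topspace X \<and> subtopology X S homeomorphic_space top_of_set (sphere (0::complex) 1)"

(* Up to homeomorphism: a quotient of the disjoint union of n > 0 copies of [0,1] whose
   identifications q x = q y involve only end points (of the same or of different copies);
   a point of the disjoint union is a pair (index of the arc, parameter on it). *)
definition graph_space :: "'a topology \<Rightarrow> bool" where
  "graph_space X \<longleftrightarrow>
     connected_space X \<and>
     (\<exists>(n::nat) q. n > 0 \<and>
        quotient_map (sum_topology (\<lambda>_. unit_interval_topology) {..<n}) X q \<and>
        (\<forall>x \<in> {..<n} \<times> {0..1}. \<forall>y \<in> {..<n} \<times> {0..1}.
           q x = q y \<longrightarrow> x = y \<or> (snd x \<in> {0, 1} \<and> snd y \<in> {0, 1})))"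

(* The points p 1, ..., p n need not be distinct. *)
definition n_arc_connected :: "nat \<Rightarrow> 'a topology \<Rightarrow> bool" where
  "n_arc_connected n X \<longleftrightarrow>
     (\<forall>p. (\<forall>i \<in> {1..n}. p i \<in> topspace X) \<longrightarrow>
        (\<exists>A. arc_in X A \<and> (\<forall>i \<in> {1..n}. p i \<in> A)))"

definition omega_arc_connected :: "'a topology \<Rightarrow> bool" where
  "omega_arc_connected X \<longleftrightarrow> (\<forall>n\<ge>1. n_arc_connected n X)"

(* For real sets, is_interval covers open, closed, half-open, bounded and unbounded intervals. *)
definition injective_interval_image :: "'a topology \<Rightarrow> bool" where
  "injective_interval_image X \<longleftrightarrow>
     (\<exists>(I::real set) f. is_interval I \<and> continuous_map (top_of_set I) X f \<and>
        inj_on f I \<and> f ` I = topspace X)"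

(* The predicates below describe a space up to homeomorphism.  In the last four, the Hausdorff
   condition makes the compact pieces closed, so that the topology of X is determined by the
   topologies of the pieces. *)

definition is_arc :: "'a topology \<Rightarrow> bool" where
  "is_arc X \<longleftrightarrow> arc_in X (topspace X)"

definition is_simple_closed_curve :: "'a topology \<Rightarrow> bool" where
  "is_simple_closed_curve X \<longleftrightarrow> simple_closed_curve_in X (topspace X)"

definition is_figure_eight :: "'a topology \<Rightarrow> bool" where
  "is_figure_eight X \<longleftrightarrow>
     Hausdorff_space X \<and>
     (\<exists>S T c. simple_closed_curve_in X S \<and> simple_closed_curve_in X T \<and>
        topspace X = S \<union> T \<and> S \<inter> T = {c})"

definition is_lollipop :: "'a topology \<Rightarrow> bool" where
  "is_lollipop X \<longleftrightarrow>
     Hausdorff_space X \<and>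
     (\<exists>S A a b. simple_closed_curve_in X S \<and> arc_in_with_ends X A a b \<and>
        topspace X = S \<union> A \<and> S \<inter> A = {a})"

definition is_dumbbell :: "'a topology \<Rightarrow> bool" where
  "is_dumbbell X \<longleftrightarrow>
     Hausdorff_space X \<and>
     (\<exists>S T A a b. simple_closed_curve_in X S \<and> simple_closed_curve_in X T \<and>
        arc_in_with_ends X A a b \<and> topspace X = S \<union> T \<union> A \<and>
        S \<inter> T = {} \<and> S \<inter> A = {a} \<and> T \<inter> A = {b})"

definition is_theta_curve :: "'a topology \<Rightarrow> bool" where
  "is_theta_curve X \<longleftrightarrow>
     Hausdorff_space X \<and>
     (\<exists>A B C a b. arc_in_with_ends X A a b \<and> arc_in_with_ends X B a b \<and>
        arc_in_with_ends X C a b \<and> topspace X = A \<union> B \<union> C \<and>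
        A \<inter> B = {a, b} \<and> A \<inter> C = {a, b} \<and> B \<inter> C = {a, b})"

end

theory Submission
  imports Defs
begin

text \<open>
  A continuous injection of an interval onto a Hausdorff space restricts to an arc on every compact
  subinterval, which gives 3) \<open>\<Longrightarrow>\<close> 2), and each of the six graphs is traced injectively by an
  interval. For 1) \<open>\<Longrightarrow>\<close> 4), write \<open>G\<close> with as few edges as possible, so that no vertex has
  degree 2 unless \<open>G\<close> is a circle. An arc contains at most two of the half-edges at a vertex,
  it ends inside every half-edge whose far point it contains without containing the half-edge, and
  it ends at every vertex of degree 1 that it contains. As an arc has only two ends, an arc through
  suitable points forces \<open>\<Sum>\<^sub>v |deg v - 2| \<le> 2\<close>; marking each edge by its midpoint lets a point
  serve both of its half-edges, so that seven points suffice. Only the six graphs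
  satisfy this bound.
\<close>

section \<open>Arcs and simple closed curves\<close>

text \<open>The number of edges is not bounded beforehand, so the degree bound is never applied to
  the whole graph. It is applied to a few half-edges \<open>K\<close> and leaves \<open>L\<close>,
  in the form \<open>card K + card L \<le> 2 * card W + 2\<close> with \<open>W\<close> containing
  the vertices of \<open>K\<close>; connectedness then lists all vertices. Marking edges by
  midpoints has a price: an arc that ends exactly at a midpoint could pay for both halves of that
  edge with a single end. An arc through the midpoint that misses part of both halves is trapped in
  that edge, which is why \<open>K\<close> has to meet two edges. The number seven comes from the
  tightest configurations: four half-edges at one vertex and three at another (7 > 6), two trivalent
  vertices and a leaf (6 + 1 > 6), and three trivalent vertices (9 > 8), where two edges contribute
  both halves and 9 - 2 midpoints are enough.\<close>

lemma homeomorphic_map_onto_image: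
  assumes "compact_space X" "Hausdorff_space Y" "continuous_map X Y f" "inj_on f (topspace X)"
  shows "homeomorphic_map X (subtopology Y (f ` topspace X)) f"
proof (rule bijective_closed_imp_homeomorphic_map)
  show c: "continuous_map X (subtopology Y (f ` topspace X)) f"
    using assms(3) by (simp add: continuous_map_in_subtopology)
  show "closed_map X (subtopology Y (f ` topspace X)) f"
    using assms c by (intro continuous_imp_closed_map_gen Hausdorff_imp_kc_space)
      (auto intro: Hausdorff_space_subtopology)
  show "f ` topspace X = topspace (subtopology Y (f ` topspace X))"
    using assms(3) continuous_map_image_subset_topspace by fastforce
qed (use assms in auto)

lemma compact_space_interval: "compact_space (top_of_set {a..b::real})"
  by (simp add: compact_space_subtopology compactin_euclidean_iff)

lemma continuous_map_reparametrize:
  fixes f :: "real \<Rightarrow> 'a"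
  assumes "continuous_map (top_of_set S) X f" "continuous_on T r" "r ` T \<subseteq> S"
  shows "continuous_map (top_of_set T) X (\<lambda>t. f (r t))"
proof -
  have "continuous_map (top_of_set T) (top_of_set S) r"
    using assms(2,3) by (simp add: continuous_map_in_subtopology image_subset_iff_funcset)
  from continuous_map_compose[OF this assms(1)] show ?thesis by (simp add: o_def)
qed

text \<open>Compactness of the interval and the Hausdorff property turn a continuous injection into
  an embedding, so arcs can be produced without constructing inverses. The affine map
  \<open>r\<close> only rescales to the unit interval.\<close>

lemma arc_in_with_ends_image:
  fixes f :: "real \<Rightarrow> 'a"
  assumes X: "Hausdorff_space X" and f: "continuous_map (top_of_set {a..b}) X f"
    and inj: "inj_on f {a..b}" and "a < b"
  shows "arc_in_with_ends X (f ` {a..b}) (f a) (f b)"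
proof -
  define r where "r \<equiv> \<lambda>s. a + (b - a) * s"
  have r: "r ` {0..1} = {a..b}"
  proof
    show "r ` {0..1} \<subseteq> {a..b}"
      using \<open>a < b\<close> by (auto simp: r_def mult_left_le)
        (metis add.commute diff_add_cancel diff_ge_0_iff_ge less_eq_real_def mult_left_le add_le_cancel_right)
    show "{a..b} \<subseteq> r ` {0..1}"
    proof
      fix x assume "x \<in> {a..b}"
      then have "x = r ((x - a) / (b - a))" "(x - a) / (b - a) \<in> {0..1}"
        using \<open>a < b\<close> by (auto simp: r_def)
      then show "x \<in> r ` {0..1}" by blast
    qed
  qed
  have inj_r: "inj_on r {0..1}"
    using \<open>a < b\<close> by (auto simp: r_def inj_on_def)
  let ?h = "\<lambda>s. f (r s)"
  have "continuous_map unit_interval_topology X ?h"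
    by (rule continuous_map_reparametrize[OF f]) (use r in \<open>auto simp: r_def intro!: continuous_intros\<close>)
  moreover have "inj_on ?h {0..1}"
    using comp_inj_on[OF inj_r] inj r by (simp add: o_def)
  moreover have "?h ` {0..1} = f ` {a..b}"
    using r by (metis image_image)
  ultimately have "homeomorphic_map unit_interval_topology (subtopology X (f ` {a..b})) ?h"
    using homeomorphic_map_onto_image[OF compact_space_interval X, of 0 1 ?h] by simp
  moreover have "f ` {a..b} \<subseteq> topspace X"
    using continuous_map_image_subset_topspace[OF f] by simp
  moreover have "?h 0 = f a" "?h 1 = f b"
    by (auto simp: r_def)
  ultimately show ?thesis
    unfolding arc_in_with_ends_def by blast
qed

lemma arc_in_with_ends_param:
  assumes "arc_in_with_ends X A a b"
  obtains h where "continuous_map unit_interval_topology X h" "inj_on h {0..1}"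
    "h ` {0..1} = A" "h 0 = a" "h 1 = b"
proof -
  obtain h where A: "A \<subseteq> topspace X"
    and h: "homeomorphic_map unit_interval_topology (subtopology X A) h" "h 0 = a" "h 1 = b"
    using assms unfolding arc_in_with_ends_def by blast
  show thesis
  proof
    show "continuous_map unit_interval_topology X h"
      using h homeomorphic_imp_continuous_map continuous_map_into_fulltopology by blast
    show "inj_on h {0..1}"
      using homeomorphic_imp_injective_map[OF h(1)] by simp
    show "h ` {0..1} = A"
      using homeomorphic_imp_surjective_map[OF h(1)] A by auto
  qed (use h in auto)
qed

lemma arc_in_with_ends_sym:
  assumes "Hausdorff_space X" "arc_in_with_ends X A a b"
  shows "arc_in_with_ends X A b a"
proof -
  obtain h where h: "continuous_map unit_interval_topology X h" "inj_on h {0..1}"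
    "h ` {0..1} = A" "h 0 = a" "h 1 = b"
    using assms(2) by (rule arc_in_with_ends_param)
  let ?k = "\<lambda>s. h (1 - s)"
  have im: "(\<lambda>s::real. 1 - s) ` {0..1} = {0..1}"
    by (auto simp: image_iff intro!: bexI[of _ "1 - _"])
  have "continuous_map unit_interval_topology X ?k"
    by (rule continuous_map_reparametrize[OF h(1)]) (auto intro!: continuous_intros)
  moreover have "inj_on ?k {0..1}"
  proof (rule inj_onI)
    fix s t :: real assume "s \<in> {0..1}" "t \<in> {0..1}" "h (1 - s) = h (1 - t)"
    then show "s = t" using inj_onD[OF h(2), of "1 - s" "1 - t"] by auto
  qed
  moreover have "?k ` {0..1} = A"
    using h(3) im by (metis image_image)
  ultimately show ?thesis
    using arc_in_with_ends_image[OF assms(1), of 0 1 ?k] h by simp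
qed

lemma arc_in_iff_ends: "arc_in X A \<longleftrightarrow> (\<exists>a b. arc_in_with_ends X A a b)"
  unfolding arc_in_def arc_in_with_ends_def
  by (subst homeomorphic_space_sym) (auto simp: homeomorphic_space)

text \<open>Presents the circle as the unit interval with its ends glued, so that maps out of the
  circle can be obtained from closed paths.\<close>

lemma quotient_map_circle:
  "quotient_map unit_interval_topology (top_of_set (sphere (0::complex) 1)) (\<lambda>t. cis (2 * pi * t))"
proof (rule continuous_closed_imp_quotient_map)
  show c: "continuous_map unit_interval_topology (top_of_set (sphere (0::complex) 1)) (\<lambda>t. cis (2 * pi * t))"
    by (auto simp: continuous_map_in_subtopology intro!: continuous_intros)
  show "closed_map unit_interval_topology (top_of_set (sphere (0::complex) 1)) (\<lambda>t. cis (2 * pi * t))"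
    using c by (intro continuous_imp_closed_map_gen Hausdorff_imp_kc_space)
      (auto intro: compact_space_interval Hausdorff_space_subtopology)
  show "(\<lambda>t. cis (2 * pi * t)) ` topspace unit_interval_topology = topspace (top_of_set (sphere (0::complex) 1))"
  proof -
    have "z \<in> (\<lambda>t. cis (2 * pi * t)) ` {0..1}" if "norm z = 1" for z :: complex
    proof -
      have "z = cis (Arg2pi z)"
        using Arg2pi_eq[of z] that cis_conv_exp by (metis mult.commute mult_1 of_real_1)
      then have "z = cis (2 * pi * (Arg2pi z / (2 * pi)))" by simp
      moreover have "Arg2pi z / (2 * pi) \<in> {0..1}"
        using Arg2pi_ge_0 Arg2pi_lt_2pi[of z] by (auto simp: divide_simps)
      ultimately show ?thesis by blast
    qed
    then show ?thesis by auto
  qed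
qed

lemma cis_eq_cis_unit:
  assumes "s \<in> {0..1}" "t \<in> {0..1}" "cis (2 * pi * s) = cis (2 * pi * t)"
  shows "s = t \<or> {s, t} = {0, 1}"
proof -
  have "exp (\<i> * complex_of_real (2 * pi * s)) = exp (\<i> * complex_of_real (2 * pi * t))"
    using assms(3) by (simp add: cis_conv_exp)
  then obtain n :: int where "\<i> * complex_of_real (2 * pi * s) = \<i> * complex_of_real (2 * pi * t) + (of_int (2 * n) * pi) * \<i>"
    using exp_eq by blast
  then have "\<i> * complex_of_real (2 * pi * s) = \<i> * complex_of_real (2 * pi * t + 2 * of_int n * pi)"
    by (simp add: algebra_simps)
  then have "complex_of_real (2 * pi * s) = complex_of_real (2 * pi * t + 2 * of_int n * pi)"
    by (metis complex_i_not_zero mult_left_cancel)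
  then have "2 * pi * s = 2 * pi * t + 2 * of_int n * pi"
    by (metis of_real_eq_iff)
  then have "2 * pi * s = 2 * pi * (t + of_int n)"
    by (simp add: algebra_simps)
  then have st: "s = t + of_int n" by simp
  then have "n \<le> 1" "n \<ge> -1" using assms(1,2) by auto
  then have "n = 0 \<or> n = 1 \<or> n = -1" by auto
  then show ?thesis using st assms(1,2) by auto
qed

text \<open>The closed path descends through \<open>quotient_map_circle\<close>. The only
  coincidence allowed on the interval is the one already made in the quotient, so the descended map
  is injective, and compactness makes it an embedding.\<close>

lemma simple_closed_curve_in_image:
  assumes X: "Hausdorff_space X" and f: "continuous_map unit_interval_topology X f"
    and inj: "\<And>s t. s \<in> {0..1} \<Longrightarrow> t \<in> {0..1} \<Longrightarrow> f s = f t \<Longrightarrow> s = t \<or> {s, t} = {0, 1}"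
    and "f 0 = f 1"
  shows "simple_closed_curve_in X (f ` {0..1})"
proof -
  obtain g where g: "continuous_map (top_of_set (sphere (0::complex) 1)) X g"
    "g ` topspace (top_of_set (sphere (0::complex) 1)) = f ` topspace unit_interval_topology"
    "\<And>t. t \<in> topspace unit_interval_topology \<Longrightarrow> g (cis (2 * pi * t)) = f t"
  proof (rule quotient_map_lift_exists[OF quotient_map_circle f])
    fix s t assume "s \<in> topspace unit_interval_topology" "t \<in> topspace unit_interval_topology"
      "cis (2 * pi * s) = cis (2 * pi * t)"
    then have "s = t \<or> {s, t} = {0, 1}" using cis_eq_cis_unit by simp
    then show "f s = f t" using \<open>f 0 = f 1\<close> by (auto simp: doubleton_eq_iff)
  qed blast
  have "inj_on g (sphere 0 1)"
  proof (rule inj_onI)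
    fix x y :: complex assume xy: "x \<in> sphere 0 1" "y \<in> sphere 0 1" "g x = g y"
    have "sphere (0::complex) 1 = (\<lambda>t. cis (2 * pi * t)) ` {0..1}"
      using quotient_imp_surjective_map[OF quotient_map_circle] by simp
    then obtain s t where st: "s \<in> {0..1}" "t \<in> {0..1}" "x = cis (2 * pi * s)" "y = cis (2 * pi * t)"
      using xy by blast
    then have "f s = f t" using g(3) xy by auto
    then have "s = t \<or> {s, t} = {0, 1}" using inj st by blast
    then show "x = y" using st by (auto simp: doubleton_eq_iff)
  qed
  then have "homeomorphic_map (top_of_set (sphere (0::complex) 1)) (subtopology X (f ` {0..1})) g"
    using homeomorphic_map_onto_image[OF _ X g(1)] g(2)
    by (simp add: compact_space_subtopology compactin_euclidean_iff)
  then show ?thesis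
    using continuous_map_image_subset_topspace[OF f] unfolding simple_closed_curve_in_def
    by (metis homeomorphic_map_imp_homeomorphic_space homeomorphic_space_sym topspace_euclidean_subtopology)
qed

text \<open>A rotation of the circle (the factor \<open>z\<close> in \<open>r\<close>) moves the
  base point to the prescribed \<open>c\<close>, so that a curve can be entered and left at the
  point where it is attached to the rest of the graph.\<close>

lemma simple_closed_curve_in_param:
  assumes "simple_closed_curve_in X S" "c \<in> S"
  obtains f where "continuous_map unit_interval_topology X f" "f ` {0..1} = S"
    "f 0 = c" "f 1 = c" "inj_on f {0..<1}" "inj_on f {0<..1}"
proof -
  obtain g where S: "S \<subseteq> topspace X"
    and g: "homeomorphic_map (top_of_set (sphere (0::complex) 1)) (subtopology X S) g"
    using assms homeomorphic_space homeomorphic_space_sym unfolding simple_closed_curve_in_def by metis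
  have gim: "g ` sphere 0 1 = S"
    using homeomorphic_imp_surjective_map[OF g] S by auto
  have ginj: "inj_on g (sphere 0 1)"
    using homeomorphic_imp_injective_map[OF g] by simp
  obtain z where z: "norm z = 1" "g z = c" using gim assms(2) by auto
  then have "z \<noteq> 0" by auto
  define r where "r \<equiv> \<lambda>t. cis (2 * pi * t) * z"
  have r: "r ` {0..1} = sphere 0 1"
  proof
    show "r ` {0..1} \<subseteq> sphere 0 1" using z by (auto simp: r_def norm_mult)
    show "sphere 0 1 \<subseteq> r ` {0..1}"
    proof
      fix w :: complex assume "w \<in> sphere 0 1"
      then have "w / z \<in> sphere 0 1" using z by (simp add: norm_divide)
      also have "sphere (0::complex) 1 = (\<lambda>t. cis (2 * pi * t)) ` {0..1}"
        using quotient_imp_surjective_map[OF quotient_map_circle] by simp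
      finally obtain t where "t \<in> {0..1}" "w / z = cis (2 * pi * t)" by blast
      then show "w \<in> r ` {0..1}" using \<open>z \<noteq> 0\<close> by (auto simp: r_def field_simps intro!: bexI[of _ t])
    qed
  qed
  have rinj: "s = t \<or> {s, t} = {0, 1}" if "s \<in> {0..1}" "t \<in> {0..1}" "r s = r t" for s t
    using that \<open>z \<noteq> 0\<close> cis_eq_cis_unit by (simp add: r_def)
  have inj: "s = t \<or> {s, t} = {0, 1}" if "s \<in> {0..1}" "t \<in> {0..1}" "g (r s) = g (r t)" for s t
  proof -
    have "r s \<in> sphere 0 1" "r t \<in> sphere 0 1" using r that by blast+
    then show ?thesis using inj_onD[OF ginj] rinj that by metis
  qed
  show thesis
  proof
    have "continuous_map (top_of_set (sphere (0::complex) 1)) X g"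
      using g homeomorphic_imp_continuous_map continuous_map_into_fulltopology by blast
    moreover have "continuous_map unit_interval_topology (top_of_set (sphere (0::complex) 1)) r"
      using r by (auto simp: continuous_map_in_subtopology r_def intro!: continuous_intros)
    ultimately show "continuous_map unit_interval_topology X (\<lambda>t. g (r t))"
      using continuous_map_compose[of _ _ r X g] unfolding o_def by blast
    show "(\<lambda>t. g (r t)) ` {0..1} = S" using r gim by (metis image_image)
    show "g (r 0) = c" "g (r 1) = c" using z by (auto simp: r_def)
    show "inj_on (\<lambda>t. g (r t)) {0..<1}"
    proof (rule inj_onI)
      fix s t :: real assume "s \<in> {0..<1}" "t \<in> {0..<1}" "g (r s) = g (r t)"
      then show "s = t" using inj[of s t] by (auto simp: doubleton_eq_iff)
    qed
    show "inj_on (\<lambda>t. g (r t)) {0<..1}"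
    proof (rule inj_onI)
      fix s t :: real assume "s \<in> {0<..1}" "t \<in> {0<..1}" "g (r s) = g (r t)"
      then show "s = t" using inj[of s t] by (auto simp: doubleton_eq_iff)
    qed
  qed
qed

lemma continuous_map_join:
  fixes f g :: "real \<Rightarrow> 'a"
  assumes f: "continuous_map (top_of_set {a..b}) X f" and g: "continuous_map (top_of_set {b..c}) X g"
    and "f b = g b"
  shows "continuous_map (top_of_set {a..c}) X (\<lambda>t. if t \<le> b then f t else g t)"
proof (rule continuous_map_cases_le)
  show "continuous_map (subtopology (top_of_set {a..c}) {x \<in> topspace (top_of_set {a..c}). x \<le> b}) X f"
    unfolding subtopology_subtopology
    by (rule continuous_map_from_subtopology_mono[OF f]) auto
  show "continuous_map (subtopology (top_of_set {a..c}) {x \<in> topspace (top_of_set {a..c}). b \<le> x}) X g"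
    unfolding subtopology_subtopology
    by (rule continuous_map_from_subtopology_mono[OF g]) auto
qed (use assms in auto)

lemma inj_on_join:
  fixes f g :: "'a::linorder \<Rightarrow> 'b"
  assumes "inj_on f S" "inj_on g T" "S \<subseteq> {..b}" "T \<subseteq> {b..}" "b \<in> S" "b \<in> T" "f b = g b"
    "f ` S \<inter> g ` T \<subseteq> {f b}"
  shows "inj_on (\<lambda>t. if t \<le> b then f t else g t) (S \<union> T)"
    and "(\<lambda>t. if t \<le> b then f t else g t) ` (S \<union> T) = f ` S \<union> g ` T"
proof -
  let ?h = "\<lambda>t. if t \<le> b then f t else g t"
  have S: "?h t = f t" if "t \<in> S" for t using that assms(3) by auto
  have T: "?h t = g t" if "t \<in> T" for t
    using that assms(4,7) by (cases "t = b") auto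
  have h: "s = t" if "s \<in> S" "t \<in> T" "f s = g t" for s t
  proof -
    have "f s = f b" using that assms(8) by auto
    moreover have "g t = g b" using that assms(7,8) by auto
    ultimately show ?thesis
      using that assms(1,2,5,6) by (metis inj_onD)
  qed
  show "inj_on ?h (S \<union> T)"
  proof (rule inj_onI)
    fix s t assume st: "s \<in> S \<union> T" "t \<in> S \<union> T" "?h s = ?h t"
    consider "s \<in> S" "t \<in> S" | "s \<in> S" "t \<in> T" | "s \<in> T" "t \<in> S" | "s \<in> T" "t \<in> T"
      using st by blast
    then show "s = t"
      by cases (use st(3) S T h assms(1,2) in \<open>metis inj_onD\<close>)+
  qed
  show "?h ` (S \<union> T) = f ` S \<union> g ` T"
    unfolding image_Un using S T by (intro arg_cong2[of _ _ _ _ "(\<union>)"] image_cong) auto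
qed

section \<open>Injective images of intervals\<close>

definition injective_piece :: "'a topology \<Rightarrow> real set \<Rightarrow> 'a set \<Rightarrow> (real \<Rightarrow> 'a) \<Rightarrow> bool" where
  "injective_piece X J P f \<longleftrightarrow> continuous_map (top_of_set J) X f \<and> inj_on f J \<and> f ` J = P"

lemma injective_pieceI:
  assumes "continuous_map (top_of_set K) X f" "J \<subseteq> K" "inj_on f J" "f ` J = P"
  shows "injective_piece X J P f"
  using continuous_map_from_subtopology_mono[OF assms(1,2)] assms(3,4) by (simp add: injective_piece_def)

lemma injective_piece_shift:
  assumes "injective_piece X J P f"
  shows "injective_piece X ((\<lambda>t. t + k) ` J) P (\<lambda>t. f (t - k))"
proof -
  have "continuous_map (top_of_set ((\<lambda>t. t + k) ` J)) X (\<lambda>t. f (t - k))"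
    by (rule continuous_map_reparametrize[of J])
      (use assms in \<open>auto simp: injective_piece_def intro!: continuous_intros\<close>)
  moreover have "inj_on (\<lambda>t. f (t - k)) ((\<lambda>t. t + k) ` J)"
    using assms by (auto simp: injective_piece_def inj_on_def)
  moreover have "(\<lambda>t. f (t - k)) ` (\<lambda>t. t + k) ` J = P"
    using assms by (auto simp: injective_piece_def image_image)
  ultimately show ?thesis by (simp add: injective_piece_def)
qed

text \<open>Cutting \<open>J \<union> K\<close> at \<open>b\<close> gives back exactly
  \<open>J\<close> and \<open>K\<close>, even if these are half-open at their outer ends, so the
  pasting is along relatively closed sets. The common point is traced by both pieces at the same
  parameter \<open>b\<close>, hence only once.\<close>

lemma injective_piece_join:
  assumes f: "injective_piece X J P f" and g: "injective_piece X K Q g"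
    and "J \<subseteq> {..b}" "K \<subseteq> {b..}" "b \<in> J" "b \<in> K" "f b = g b" "P \<inter> Q \<subseteq> {f b}"
  shows "injective_piece X (J \<union> K) (P \<union> Q) (\<lambda>t. if t \<le> b then f t else g t)"
proof -
  have "continuous_map (top_of_set (J \<union> K)) X (\<lambda>t. if t \<le> b then f t else g t)"
  proof (rule continuous_map_cases_le)
    have "{x \<in> topspace (top_of_set (J \<union> K)). x \<le> b} = J"
      "{x \<in> topspace (top_of_set (J \<union> K)). b \<le> x} = K"
      using assms(3-6) by (auto simp: order_antisym)
    then show "continuous_map (subtopology (top_of_set (J \<union> K)) {x \<in> topspace (top_of_set (J \<union> K)). x \<le> b}) X f"
      "continuous_map (subtopology (top_of_set (J \<union> K)) {x \<in> topspace (top_of_set (J \<union> K)). b \<le> x}) X g"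
      using f g by (simp_all add: injective_piece_def subtopology_subtopology Int_absorb1)
  qed (use assms in auto)
  moreover have "inj_on (\<lambda>t. if t \<le> b then f t else g t) (J \<union> K)"
    "(\<lambda>t. if t \<le> b then f t else g t) ` (J \<union> K) = P \<union> Q"
    using inj_on_join[of f J g K b] assms by (auto simp: injective_piece_def)
  ultimately show ?thesis by (simp add: injective_piece_def)
qed

lemma injective_interval_imageI:
  "injective_piece X J (topspace X) f \<Longrightarrow> is_interval J \<Longrightarrow> injective_interval_image X"
  unfolding injective_interval_image_def injective_piece_def by (intro exI[of _ J] exI[of _ f]) simp

lemma simple_closed_curve_pieces:
  assumes "simple_closed_curve_in X S" "c \<in> S"
  obtains f where "injective_piece X {0..<1} S f" "injective_piece X {0<..1} S f" "f 0 = c" "f 1 = c"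
proof -
  obtain f where f: "continuous_map unit_interval_topology X f" "f ` {0..1} = S"
    "f 0 = c" "f 1 = c" "inj_on f {0..<1}" "inj_on f {0<..1}"
    using simple_closed_curve_in_param[OF assms] .
  have "{0..1::real} = insert 1 {0..<1}" "{0..1::real} = insert 0 {0<..1}" by auto
  then have "S = insert c (f ` {0..<1})" "S = insert c (f ` {0<..1})"
    using f by (metis image_insert)+
  moreover have "c \<in> f ` {0..<1}" "c \<in> f ` {0<..1}"
    using f(3,4) by (force intro: image_eqI[of _ _ "0::real"], force intro: image_eqI[of _ _ "1::real"])
  ultimately have "f ` {0..<1} = S" "f ` {0<..1} = S" by auto
  then show thesis
    using f by (intro that[of f] injective_pieceI[OF f(1)]) auto
qed

text \<open>Dropping an end now loses a point. The half-open versions serve the theta curve, where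
  two of the arcs must give up an end point that is traced elsewhere.\<close>

lemma arc_pieces:
  assumes "arc_in_with_ends X A a b"
  obtains f where "injective_piece X {0..1} A f" "injective_piece X {0<..1} (A - {a}) f"
    "injective_piece X {0..<1} (A - {b}) f" "f 0 = a" "f 1 = b" "a \<in> A" "b \<in> A" "a \<noteq> b"
proof -
  obtain f where f: "continuous_map unit_interval_topology X f" "inj_on f {0..1}"
    "f ` {0..1} = A" "f 0 = a" "f 1 = b"
    using arc_in_with_ends_param[OF assms] .
  have "f ` {0<..1} = A - {a}" "f ` {0..<1} = A - {b}"
  proof -
    have "{0<..1} = {0..1} - {0::real}" "{0..<1} = {0..1} - {1::real}" by auto
    then show "f ` {0<..1} = A - {a}" "f ` {0..<1} = A - {b}"
      using f(3-5) inj_on_image_set_diff[OF f(2), of "{0..1}" "{0}"]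
        inj_on_image_set_diff[OF f(2), of "{0..1}" "{1}"] by simp_all
  qed
  moreover have "f 0 \<noteq> f 1" using inj_onD[OF f(2), of 0 1] by auto
  ultimately show thesis
    using f by (intro that[of f] injective_pieceI[OF f(1)]) (auto intro: inj_on_subset)
qed

lemma is_arc_injective_interval_image:
  assumes "is_arc X"
  shows "injective_interval_image X"
proof -
  obtain a b where "arc_in_with_ends X (topspace X) a b"
    using assms by (auto simp: is_arc_def arc_in_iff_ends)
  then show ?thesis
    by (rule arc_pieces) (erule injective_interval_imageI, simp add: is_interval_cc)
qed

lemma is_simple_closed_curve_injective_interval_image:
  assumes "is_simple_closed_curve X"
  shows "injective_interval_image X"
proof -
  have S: "simple_closed_curve_in X (topspace X)"
    using assms by (simp add: is_simple_closed_curve_def)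
  then obtain f where "f ` topspace X = sphere (0::complex) 1"
    by (auto simp: simple_closed_curve_in_def homeomorphic_space homeomorphic_eq_everything_map)
  moreover have "1 \<in> sphere (0::complex) 1" by simp
  ultimately obtain c where "c \<in> topspace X" by (metis imageE)
  then show ?thesis
    by (rule simple_closed_curve_pieces[OF S]) (erule injective_interval_imageI, simp add: is_interval_co)
qed

text \<open>The common point \<open>c\<close> is traced once, at parameter 1: the first circle omits
  its start and the second omits its end.\<close>

lemma is_figure_eight_injective_interval_image:
  assumes "is_figure_eight X"
  shows "injective_interval_image X"
proof -
  obtain S T c where ST: "simple_closed_curve_in X S" "simple_closed_curve_in X T"
    "topspace X = S \<union> T" "S \<inter> T = {c}"
    using assms by (auto simp: is_figure_eight_def)
  then have c: "c \<in> S" "c \<in> T" by auto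
  obtain f where f: "injective_piece X {0<..1} S f" "f 1 = c"
    using simple_closed_curve_pieces[OF ST(1) c(1)] .
  obtain g where g: "injective_piece X {0..<1} T g" "g 0 = c"
    using simple_closed_curve_pieces[OF ST(2) c(2)] .
  have g': "injective_piece X {1..<2} T (\<lambda>t. g (t - 1))"
    using injective_piece_shift[OF g(1), of 1] by simp
  have "injective_piece X ({0<..1} \<union> {1..<2}) (S \<union> T) (\<lambda>t. if t \<le> 1 then f t else g (t - 1))"
    by (rule injective_piece_join[OF f(1) g']) (use ST(4) f g in auto)
  moreover have "{0<..1} \<union> {1..<2} = {0<..<2::real}" by auto
  ultimately show ?thesis
    using ST(3) injective_interval_imageI[of X "{0<..<2}"] by (simp add: is_interval_oo)
qed

lemma is_lollipop_injective_interval_image: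
  assumes "is_lollipop X"
  shows "injective_interval_image X"
proof -
  obtain S A a b where X: "Hausdorff_space X" and SA: "simple_closed_curve_in X S" "arc_in_with_ends X A a b"
    "topspace X = S \<union> A" "S \<inter> A = {a}"
    using assms by (auto simp: is_lollipop_def)
  \<comment> \<open>The arc is run from its free end towards the circle, so that the circle comes
    last and takes the open end.\<close>
  obtain f where f: "injective_piece X {0..1} A f" "f 1 = a"
    using arc_pieces[OF arc_in_with_ends_sym[OF X SA(2)]] .
  obtain g where g: "injective_piece X {0..<1} S g" "g 0 = a"
    using simple_closed_curve_pieces[OF SA(1), of a] SA(4) by blast
  have g': "injective_piece X {1..<2} S (\<lambda>t. g (t - 1))"
    using injective_piece_shift[OF g(1), of 1] by simp
  have "injective_piece X ({0..1} \<union> {1..<2}) (A \<union> S) (\<lambda>t. if t \<le> 1 then f t else g (t - 1))"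
    by (rule injective_piece_join[OF f(1) g']) (use SA(4) f g in auto)
  moreover have "{0..1} \<union> {1..<2} = {0..<2::real}" by auto
  ultimately show ?thesis
    using SA(3) injective_interval_imageI[of X "{0..<2}"] by (simp add: Un_commute is_interval_co)
qed

lemma is_dumbbell_injective_interval_image:
  assumes "is_dumbbell X"
  shows "injective_interval_image X"
proof -
  obtain S T A a b where STA: "simple_closed_curve_in X S" "simple_closed_curve_in X T"
    "arc_in_with_ends X A a b" "topspace X = S \<union> T \<union> A" "S \<inter> T = {}" "S \<inter> A = {a}" "T \<inter> A = {b}"
    using assms by (auto simp: is_dumbbell_def)
  obtain f where f: "injective_piece X {0<..1} S f" "f 1 = a"
    using simple_closed_curve_pieces[OF STA(1), of a] STA(6) by blast
  obtain g where g: "injective_piece X {0..1} A g" "g 0 = a" "g 1 = b"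
    using arc_pieces[OF STA(3)] .
  obtain h where h: "injective_piece X {0..<1} T h" "h 0 = b"
    using simple_closed_curve_pieces[OF STA(2), of b] STA(7) by blast
  have g': "injective_piece X {1..2} A (\<lambda>t. g (t - 1))"
    using injective_piece_shift[OF g(1), of 1] by simp
  have h': "injective_piece X {2..<3} T (\<lambda>t. h (t - 2))"
    using injective_piece_shift[OF h(1), of 2] by simp
  have fg: "injective_piece X ({0<..1} \<union> {1..2}) (S \<union> A) (\<lambda>t. if t \<le> 1 then f t else g (t - 1))"
    by (rule injective_piece_join[OF f(1) g']) (use STA(6) f g in auto)
  have "injective_piece X (({0<..1} \<union> {1..2}) \<union> {2..<3}) (S \<union> A \<union> T)
    (\<lambda>t. if t \<le> 2 then if t \<le> 1 then f t else g (t - 1) else h (t - 2))"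
    by (rule injective_piece_join[OF fg h']) (use STA(5-7) g h in auto)
  moreover have "({0<..1} \<union> {1..2}) \<union> {2..<3} = {0<..<3::real}" by auto
  moreover have "S \<union> A \<union> T = topspace X" using STA(4) by auto
  ultimately show ?thesis
    using injective_interval_imageI[of X "{0<..<3}"] by (simp add: is_interval_oo)
qed

text \<open>Run along \<open>A\<close> from \<open>a\<close> to \<open>b\<close>, back along
  \<open>B\<close> to \<open>a\<close>, and along \<open>C\<close> towards \<open>b\<close>. The
  point \<open>b\<close> is traced at parameter 1 and \<open>a\<close> at parameter 2, so
  \<open>A\<close> starts just after \<open>a\<close> and \<open>C\<close> stops just before
  \<open>b\<close>.\<close>

lemma is_theta_curve_injective_interval_image:
  assumes "is_theta_curve X"
  shows "injective_interval_image X"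
proof -
  obtain A B C a b where X: "Hausdorff_space X" and ABC: "arc_in_with_ends X A a b"
    "arc_in_with_ends X B a b" "arc_in_with_ends X C a b" "topspace X = A \<union> B \<union> C"
    "A \<inter> B = {a, b}" "A \<inter> C = {a, b}" "B \<inter> C = {a, b}"
    using assms by (auto simp: is_theta_curve_def)
  obtain f where f: "injective_piece X {0<..1} (A - {a}) f" "f 1 = b" "a \<noteq> b"
    using arc_pieces[OF ABC(1)] .
  obtain g where g: "injective_piece X {0..1} B g" "g 0 = b" "g 1 = a"
    using arc_pieces[OF arc_in_with_ends_sym[OF X ABC(2)]] .
  obtain h where h: "injective_piece X {0..<1} (C - {b}) h" "h 0 = a"
    using arc_pieces[OF ABC(3)] .
  have g': "injective_piece X {1..2} B (\<lambda>t. g (t - 1))"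
    using injective_piece_shift[OF g(1), of 1] by simp
  have h': "injective_piece X {2..<3} (C - {b}) (\<lambda>t. h (t - 2))"
    using injective_piece_shift[OF h(1), of 2] by simp
  have "(A - {a}) \<inter> B \<subseteq> {b}" using ABC by auto
  then have fg: "injective_piece X ({0<..1} \<union> {1..2}) ((A - {a}) \<union> B) (\<lambda>t. if t \<le> 1 then f t else g (t - 1))"
    by (intro injective_piece_join[OF f(1) g']) (use f g in auto)
  have "((A - {a}) \<union> B) \<inter> (C - {b}) \<subseteq> {a}" using ABC by auto
  then have "injective_piece X (({0<..1} \<union> {1..2}) \<union> {2..<3}) ((A - {a}) \<union> B \<union> (C - {b}))
    (\<lambda>t. if t \<le> 2 then if t \<le> 1 then f t else g (t - 1) else h (t - 2))"
    by (intro injective_piece_join[OF fg h']) (use g h in auto)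
  moreover have "({0<..1} \<union> {1..2}) \<union> {2..<3} = {0<..<3::real}" by auto
  moreover have "(A - {a}) \<union> B \<union> (C - {b}) = topspace X" using ABC by auto
  ultimately show ?thesis
    using injective_interval_imageI[of X "{0<..<3}"] by (simp add: is_interval_oo)
qed

text \<open>The interval from the least to the greatest parameter is compact, whatever the shape of
  \<open>J\<close>. Two different parameters keep it from degenerating to a point.\<close>

lemma arc_in_image_of_interval:
  assumes X: "Hausdorff_space X" and f: "continuous_map (top_of_set J) X f" "inj_on f J"
    and J: "is_interval J" and F: "finite F" "F \<subseteq> J" and "\<exists>x\<in>F. \<exists>y\<in>F. x \<noteq> (y::real)"
  shows "\<exists>A. arc_in X A \<and> f ` F \<subseteq> A"
proof -
  define l u where "l = Min F" and "u = Max F"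
  have "F \<noteq> {}" using assms(7) by auto
  then have lu: "l \<in> F" "u \<in> F" "\<And>x. x \<in> F \<Longrightarrow> l \<le> x \<and> x \<le> u"
    using F(1) by (auto simp: l_def u_def)
  have "l < u" using assms(7) lu(3) by (metis less_le order_antisym order_trans)
  have sub: "{l..u} \<subseteq> J"
    using mem_is_interval_1_I[OF J subsetD[OF F(2) lu(1)] subsetD[OF F(2) lu(2)]] by auto
  have "arc_in_with_ends X (f ` {l..u}) (f l) (f u)"
    using sub f \<open>l < u\<close> X
    by (intro arc_in_with_ends_image continuous_map_from_subtopology_mono[OF f(1)] inj_on_subset[OF f(2) sub])
  moreover have "f ` F \<subseteq> f ` {l..u}" using lu(3) by auto
  ultimately show ?thesis using arc_in_iff_ends by blast
qed

text \<open>Two distinct points exclude the one-point space, which is the image of a degenerate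
  interval but contains no arc.\<close>

lemma injective_interval_image_omega_arc_connected:
  assumes X: "Hausdorff_space X" and "\<exists>x\<in>topspace X. \<exists>y\<in>topspace X. x \<noteq> y"
    and "injective_interval_image X"
  shows "omega_arc_connected X"
  unfolding omega_arc_connected_def n_arc_connected_def
proof (intro allI impI)
  fix n :: nat and p :: "nat \<Rightarrow> 'a"
  assume p: "\<forall>i \<in> {1..n}. p i \<in> topspace X"
  obtain J f where J: "is_interval (J :: real set)"
    and f: "continuous_map (top_of_set J) X f" "inj_on f J" "f ` J = topspace X"
    using assms(3) unfolding injective_interval_image_def by blast
  obtain x y where xy: "x \<in> J" "y \<in> J" "x \<noteq> y" using assms(2) f(3) by (metis imageE)
  \<comment> \<open>The parameters \<open>x\<close> and \<open>y\<close> are added because the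
    points \<open>p i\<close> may all coincide.\<close>
  define F where "F = {x, y} \<union> inv_into J f ` p ` {1..n}"
  have "F \<subseteq> J" using xy p f(3) by (auto simp: F_def intro!: inv_into_into)
  moreover have "p i \<in> f ` F" if "i \<in> {1..n}" for i
  proof
    show "p i = f (inv_into J f (p i))" using p f(3) that by (simp add: f_inv_into_f)
    show "inv_into J f (p i) \<in> F" using that by (simp add: F_def)
  qed
  moreover have "finite F" "\<exists>x\<in>F. \<exists>y\<in>F. x \<noteq> y"
    using xy(3) by (auto simp: F_def)
  ultimately show "\<exists>A. arc_in X A \<and> (\<forall>i \<in> {1..n}. p i \<in> A)"
    using arc_in_image_of_interval[OF X f(1,2) J, of F] by (meson subsetD)
qed

section \<open>Arcs in families of arcs that meet only in end points\<close>

text \<open>One-dimensional invariance of domain: in the coordinate \<open>k\<close> inverse to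
  \<open>f\<close>, the arc is near the interior time \<open>t\<close> a continuous injection into
  the reals, so it sweeps out a neighbourhood of its value. The point \<open>s\<close> has covered
  parameters on both sides, which yields openness along an edge and a contradiction at a
  leaf.\<close>

lemma arc_crosses_open_subarc:
  fixes h f :: "real \<Rightarrow> 'a"
  assumes X: "Hausdorff_space X"
    and h: "continuous_map unit_interval_topology X h" "inj_on h {0..1}"
    and f: "continuous_map (top_of_set {a..b}) X f" "inj_on f {a..b}"
    and U: "openin X U" "U \<subseteq> f ` {a..b}"
    and t: "0 < t" "t < 1" "h t \<in> U"
  obtains x s y where "a \<le> x" "x < s" "s < y" "y \<le> b" "f s = h t" "f ` {x..y} \<subseteq> h ` {0..1}"
proof -
  have "openin unit_interval_topology {x \<in> topspace unit_interval_topology. h x \<in> U}"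
    using h(1) U(1) by (rule openin_continuous_map_preimage)
  then obtain W where W: "open W" "{x \<in> {0..1}. h x \<in> U} = {0..1} \<inter> W"
    by (auto simp: openin_open)
  have WU: "x \<in> W \<longleftrightarrow> h x \<in> U" if "0 \<le> x" "x \<le> 1" for x
    using eqset_imp_iff[OF W(2), of x] that by simp
  have "open ({0<..<1} \<inter> W)" using W(1) by auto
  moreover have "t \<in> {0<..<1} \<inter> W" using t WU[of t] by simp
  ultimately obtain d where d: "d > 0" "cball t d \<subseteq> {0<..<1} \<inter> W"
    using open_contains_cball by blast
  define l u where "l = t - d" and "u = t + d"
  have lu_sub: "{l..u} \<subseteq> {0<..<1} \<inter> W"
    using d(2) by (simp add: l_def u_def cball_eq_atLeastAtMost)
  have lu: "l < t" "t < u" "{l..u} \<subseteq> {0..1}" "h ` {l..u} \<subseteq> U"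
  proof -
    show "l < t" "t < u" using d(1) by (simp_all add: l_def u_def)
    show "{l..u} \<subseteq> {0..1}" by (rule order_trans[OF lu_sub]) auto
    show "h ` {l..u} \<subseteq> U"
    proof (rule image_subsetI)
      fix x assume "x \<in> {l..u}"
      then have "x \<in> {0<..<1} \<inter> W" using lu_sub by blast
      then show "h x \<in> U" using WU[of x] by simp
    qed
  qed
  have "homeomorphic_map (top_of_set {a..b}) (subtopology X (f ` {a..b})) f"
    by (rule homeomorphic_map_onto_image[OF compact_space_interval X f(1),
      unfolded topspace_euclidean_subtopology, OF f(2)])
  then obtain k where k: "continuous_map (subtopology X (f ` {a..b})) (top_of_set {a..b}) k"
    "\<And>s. s \<in> {a..b} \<Longrightarrow> k (f s) = s"
    by (auto simp: homeomorphic_map_maps homeomorphic_maps_def)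
  have fk: "f (k z) = z" "k z \<in> {a..b}" if z: "z \<in> U" for z
  proof -
    obtain s where "s \<in> {a..b}" "z = f s" using z U(2) by blast
    then show "f (k z) = z" "k z \<in> {a..b}" using k(2) by auto
  qed
  have "continuous_map (top_of_set {l..u}) (subtopology X (f ` {a..b})) h"
    using continuous_map_from_subtopology_mono[OF h(1) lu(3)] lu(4) U(2)
    by (auto simp: continuous_map_in_subtopology)
  from continuous_map_compose[OF this k(1)]
  have cont: "continuous_on {l..u} (k \<circ> h)"
    by (simp add: continuous_map_in_subtopology)
  have inj: "inj_on (k \<circ> h) {l..u}"
  proof (rule comp_inj_on)
    show "inj_on h {l..u}" using h(2) lu(3) by (rule inj_on_subset)
    show "inj_on k (h ` {l..u})" using fk(1) lu(4) by (metis inj_on_def subsetD)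
  qed
  \<comment> \<open>\<open>k \<circ> h\<close> is monotone on \<open>{l..u}\<close>, in a direction
    that is not known; min and max absorb it.\<close>
  define x y where "x = min (k (h l)) (k (h u))" and "y = max (k (h l)) (k (h u))"
  have "x < k (h t)" "k (h t) < y"
    using continuous_inj_imp_mono[OF lu(1,2) cont inj] by (auto simp: x_def y_def)
  moreover have "x \<in> (k \<circ> h) ` {l..u}" "y \<in> (k \<circ> h) ` {l..u}"
    using lu(1,2) by (auto simp: x_def y_def min_def max_def)
  then have "{x..y} \<subseteq> (k \<circ> h) ` {l..u}"
    using cont by (intro connected_contains_Icc connected_continuous_image) auto
  then have "f ` {x..y} \<subseteq> h ` {l..u}"
    using fk(1) lu(4) by (force simp: subset_iff)
  moreover have "x \<in> {a..b}" "y \<in> {a..b}"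
    using fk(2) lu(1,2,4) by (auto simp: x_def y_def min_def max_def subset_iff)
  ultimately show thesis
    using fk(1)[OF t(3)] lu(3) by (intro that[of x "k (h t)" y]) auto
qed

text \<open>A graph presented by its parametrized edges. The quotient topology is replaced by the
  Hausdorff property, which makes the compact edges closed. The index set is an arbitrary finite set
  of numbers, so that an edge can be deleted without renumbering.\<close>

locale arc_family =
  fixes X :: "'a topology" and I :: "nat set" and g :: "nat \<Rightarrow> real \<Rightarrow> 'a"
  assumes Hausdorff: "Hausdorff_space X" and connected: "connected_space X"
    and finite_I: "finite I" and nonempty_I: "I \<noteq> {}"
    and cont: "i \<in> I \<Longrightarrow> continuous_map unit_interval_topology X (g i)"
    and cover: "topspace X = (\<Union>i\<in>I. g i ` {0..1})"
    and only_ends: "i \<in> I \<Longrightarrow> j \<in> I \<Longrightarrow> s \<in> {0..1} \<Longrightarrow> t \<in> {0..1} \<Longrightarrow> g i s = g j t \<Longrightarrow>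
        (i = j \<and> s = t) \<or> (s \<in> {0, 1} \<and> t \<in> {0, 1})"

text \<open>The half-edge \<open>(i, b)\<close> is the arc \<open>i\<close> traversed from its start (\<open>b = False\<close>) or from its end
  (\<open>b = True\<close>); it is attached to the vertex at its parameter 0.\<close>

definition half_edge :: "(nat \<Rightarrow> real \<Rightarrow> 'a) \<Rightarrow> nat \<times> bool \<Rightarrow> real \<Rightarrow> 'a" where
  "half_edge g p s = g (fst p) (if snd p then 1 - s else s)"

definition flip :: "nat \<times> bool \<Rightarrow> nat \<times> bool" where
  "flip p = (fst p, \<not> snd p)"

lemma flip_simps [simp]: "fst (flip p) = fst p" "snd (flip p) = (\<not> snd p)" "flip (flip p) = p" "flip p \<noteq> p"
  by (auto simp: flip_def prod_eq_iff)

lemma half_edge_flip: "half_edge g (flip p) s = half_edge g p (1 - s)"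
  by (simp add: half_edge_def flip_def)

lemma same_edge_iff: "fst p = fst q \<longleftrightarrow> q = p \<or> q = flip p"
  by (auto simp: flip_def prod_eq_iff)

context arc_family
begin

abbreviation "H \<equiv> half_edge g"
abbreviation "half_edges \<equiv> I \<times> (UNIV :: bool set)"

text \<open>Its cardinality is the degree of \<open>v\<close>: a loop at \<open>v\<close>
  contributes both of its half-edges and so counts twice.\<close>

definition incident :: "'a \<Rightarrow> (nat \<times> bool) set" where
  "incident v = {p \<in> half_edges. H p 0 = v}"

lemma finite_half_edges: "finite half_edges"
  using finite_I by simp

lemma finite_incident: "finite (incident v)"
  using finite_half_edges by (rule rev_finite_subset) (auto simp: incident_def)

lemma flip_in [simp]: "flip p \<in> half_edges \<longleftrightarrow> p \<in> half_edges"
  by (auto simp: flip_def mem_Times_iff)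

lemma half_edge_eqD:
  assumes "p \<in> half_edges" "q \<in> half_edges" "s \<in> {0..1}" "t \<in> {0..1}" "H p s = H q t"
  shows "(q = p \<and> t = s) \<or> (q = flip p \<and> t = 1 - s) \<or> (s \<in> {0, 1} \<and> t \<in> {0, 1})"
proof -
  let ?r = "\<lambda>p s. if snd p then 1 - s else s :: real"
  have "(fst p = fst q \<and> ?r p s = ?r q t) \<or> (?r p s \<in> {0, 1} \<and> ?r q t \<in> {0, 1})"
    using assms by (intro only_ends) (auto simp: half_edge_def)
  then show ?thesis
    by (cases p; cases q) (auto simp: flip_def split: if_splits)
qed

lemma continuous_half_edge:
  assumes "p \<in> half_edges"
  shows "continuous_map unit_interval_topology X (H p)"
proof -
  have "continuous_map unit_interval_topology X (\<lambda>s. g (fst p) (if snd p then 1 - s else s))"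
  proof (rule continuous_map_reparametrize[OF cont])
    show "fst p \<in> I" using assms by auto
    show "continuous_on {0..1} (\<lambda>s::real. if snd p then 1 - s else s)"
    proof -
      have "continuous_on {0..1} (\<lambda>s::real. 1 - s)" by (intro continuous_intros)
      then show ?thesis by (cases "snd p") simp_all
    qed
  qed auto
  then show ?thesis by (simp add: half_edge_def[abs_def])
qed

lemma half_edge_in_topspace: "p \<in> half_edges \<Longrightarrow> s \<in> {0..1} \<Longrightarrow> H p s \<in> topspace X"
  using continuous_map_image_subset_topspace[OF continuous_half_edge, of p] by auto

lemma half_edge_image: "half_edge g p ` {0..1} = g (fst p) ` {0..1}"
proof (cases "snd p")
  case True
  have im: "(\<lambda>s. 1 - s) ` {0..1} = {0..1::real}" by (simp add: image_diff_atLeastAtMost)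
  have "half_edge g p ` {0..1} = g (fst p) ` (\<lambda>s. 1 - s) ` {0..1}"
    using True by (simp add: half_edge_def image_image del: image_diff_atLeastAtMost)
  also have "\<dots> = g (fst p) ` {0..1}" by (simp only: im)
  finally show ?thesis .
qed (simp add: half_edge_def)

lemma closed_half_edge_part:
  assumes "p \<in> half_edges" "{a..b} \<subseteq> {0..1}"
  shows "closedin X (H p ` {a..b})"
  using assms by (intro compactin_imp_closedin[OF Hausdorff] image_compactin[OF _ continuous_half_edge])
    (auto simp: compactin_subtopology)

lemma closed_edges:
  assumes "J \<subseteq> I"
  shows "closedin X (\<Union>i\<in>J. g i ` {0..1})"
proof (rule closedin_Union)
  show "finite ((\<lambda>i. g i ` {0..1}) ` J)" using assms finite_I finite_subset by blast
  show "closedin X T" if "T \<in> (\<lambda>i. g i ` {0..1}) ` J" for T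
    using that assms closed_half_edge_part[of "(_, False)" 0 1] by (auto simp: half_edge_image)
qed

text \<open>The two ends of a loop are the only coincidence within one edge; keeping away from
  either end excludes it.\<close>

lemma half_edge_inj_on:
  assumes "p \<in> half_edges" "0 \<le> a" "b \<le> 1" "0 < a \<or> b < 1"
  shows "inj_on (H p) {a..b}"
proof (rule inj_onI)
  fix s t assume "s \<in> {a..b}" "t \<in> {a..b}" "H p s = H p t"
  then show "s = t" using half_edge_eqD[of p p s t] assms by (auto simp: eq_commute[of _ "flip _"])
qed

text \<open>The complement consists of the other edges and the two outer parts of this one, a finite
  union of compact sets.\<close>

lemma open_half_edge_part:
  assumes p: "p \<in> half_edges" and ab: "0 \<le> a" "b \<le> 1"
  shows "openin X (H p ` {a<..<b})"
proof -
  let ?C = "(\<Union>i\<in>I - {fst p}. g i ` {0..1}) \<union> (H p ` {0..a} \<union> H p ` {b..1})"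
  have "closedin X ?C" if "a < b"
    using p ab that by (intro closedin_Un closed_edges closed_half_edge_part) auto
  moreover have "H p ` {a<..<b} = topspace X - ?C"
  proof (rule set_eqI)
    fix x
    show "x \<in> H p ` {a<..<b} \<longleftrightarrow> x \<in> topspace X - ?C"
    proof
      assume "x \<in> H p ` {a<..<b}"
      then obtain s where s: "a < s" "s < b" "x = H p s" by auto
      have "x \<in> topspace X" using s half_edge_in_topspace[OF p, of s] ab by auto
      moreover have False if "i \<in> I" "i \<noteq> fst p" "t \<in> {0..1}" "x = g i t" for i t
        using half_edge_eqD[of p "(i, False)" s t] that p s ab by (auto simp: half_edge_def flip_def)
      moreover have False if "t \<in> {0..a} \<or> t \<in> {b..1}" "x = H p t" for t
        using half_edge_eqD[of p p s t] that p s ab by (auto simp: eq_commute[of _ "flip _"])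
      ultimately show "x \<in> topspace X - ?C" by blast
    next
      assume x: "x \<in> topspace X - ?C"
      then obtain i s where "i \<in> I" "s \<in> {0..1}" "x = g i s" using cover by auto
      moreover from this have "i = fst p" using x by blast
      ultimately have "x \<in> H p ` {0..1}" by (simp add: half_edge_image)
      then obtain s where s: "s \<in> {0..1}" "x = H p s" by auto
      then have "s \<notin> {0..a}" "s \<notin> {b..1}" using x by auto
      then show "x \<in> H p ` {a<..<b}" using s by auto
    qed
  qed
  ultimately show ?thesis
    by (cases "a < b") (auto simp: openin_closedin_eq)
qed

text \<open>Here the vertex itself can be included: the other edges and the far part of this one
  stay closed, and none of them contains a vertex at which only \<open>p\<close> starts.\<close>

lemma open_leaf_part:
  assumes p: "p \<in> half_edges" "incident (H p 0) = {p}" and b: "0 < b" "b \<le> 1"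
  shows "openin X (H p ` {0..<b})"
proof -
  let ?C = "(\<Union>i\<in>I - {fst p}. g i ` {0..1}) \<union> H p ` {b..1}"
  have *: False if "q \<in> half_edges" "q \<noteq> p" "H q 0 = H p 0" for q
    using that p(2) unfolding incident_def by blast
  have "closedin X ?C"
    using p b by (intro closedin_Un closed_edges closed_half_edge_part) auto
  moreover have "H p ` {0..<b} = topspace X - ?C"
  proof (rule set_eqI)
    fix x
    show "x \<in> H p ` {0..<b} \<longleftrightarrow> x \<in> topspace X - ?C"
    proof
      assume "x \<in> H p ` {0..<b}"
      then obtain s where s: "0 \<le> s" "s < b" "x = H p s" by auto
      have "x \<in> topspace X" using s half_edge_in_topspace[OF p(1), of s] b by auto
      moreover have False if i: "i \<in> I" "i \<noteq> fst p" "t \<in> {0..1}" "x = g i t" for i t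
      proof -
        have "H p s = H (i, False) t" using i(4) s(3) by (simp add: half_edge_def)
        moreover have "(i, False) \<noteq> p" "(i, False) \<noteq> flip p" using i(2) by (auto simp: flip_def)
        moreover have "s \<in> {0..1}" "(i, False) \<in> half_edges" using s(1,2) b i(1) by auto
        ultimately have "s \<in> {0, 1}" "t \<in> {0, 1}"
          using half_edge_eqD[of p "(i, False)" s t] p(1) i(3) by metis+
        then have "s = 0" "t \<in> {0, 1}" using s(2) b by auto
        \<comment> \<open>For an end \<open>t\<close> of the edge \<open>i\<close>, the half-edge
          \<open>(i, t = 1)\<close> is the one that starts at \<open>g i t\<close>.\<close>
        moreover from this have "H (i, t = 1) 0 = H p 0" using i(4) s(3) by (auto simp: half_edge_def)
        moreover have "(i, t = 1) \<noteq> p" "(i, t = 1) \<in> half_edges" using i(1,2) by auto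
        ultimately show False using * by metis
      qed
      moreover have False if t: "t \<in> {b..1}" "x = H p t" for t
      proof -
        have "s = 0" "t = 1"
          using half_edge_eqD[of p p s t] t p s b by (auto simp: eq_commute[of _ "flip _"])
        then show False using *[of "flip p"] p s t by (auto simp: half_edge_flip)
      qed
      ultimately show "x \<in> topspace X - ?C" by blast
    next
      assume x: "x \<in> topspace X - ?C"
      then obtain i s where "i \<in> I" "s \<in> {0..1}" "x = g i s" using cover by auto
      moreover from this have "i = fst p" using x by blast
      ultimately have "x \<in> H p ` {0..1}" by (simp add: half_edge_image)
      then obtain s where s: "s \<in> {0..1}" "x = H p s" by auto
      then have "s \<notin> {b..1}" using x by auto
      then show "x \<in> H p ` {0..<b}" using s by auto
    qed
  qed
  ultimately show ?thesis by (auto simp: openin_closedin_eq)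
qed

end

section \<open>The trace of a single arc on the edges\<close>

locale arc_in_family = arc_family X I g for X :: "'a topology" and I g +
  fixes h :: "real \<Rightarrow> 'a"
  assumes arc_cont: "continuous_map unit_interval_topology X h" and arc_inj: "inj_on h {0..1}"
begin

abbreviation "\<alpha> \<equiv> h ` {0..1}"

lemma closed_arc: "closedin X \<alpha>"
  by (intro compactin_imp_closedin[OF Hausdorff] image_compactin[OF _ arc_cont])
    (auto simp: compactin_subtopology)

lemma closed_trace:
  assumes "p \<in> half_edges"
  shows "closed {s \<in> {0..1}. H p s \<in> \<alpha>}"
proof -
  have "closedin unit_interval_topology {s \<in> topspace unit_interval_topology. H p s \<in> \<alpha>}"
    using continuous_half_edge[OF assms] closed_arc by (rule closedin_continuous_map_preimage)
  then show ?thesis by (simp add: closedin_closed_eq)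
qed

text \<open>The trace of the arc on a half-open half-edge is relatively clopen if no end of the arc lies there.\<close>

lemma half_edge_covered:
  assumes p: "p \<in> half_edges" and mid: "H p (1/2) \<in> \<alpha>"
    and ends: "h 0 \<notin> H p ` {0<..1/2}" "h 1 \<notin> H p ` {0<..1/2}"
  shows "H p ` {0..1/2} \<subseteq> \<alpha>"
proof -
  let ?S = "{0<..1/2} :: real set"
  let ?C = "{s \<in> {0..1}. H p s \<in> \<alpha>}"
  define T where "T = {s \<in> ?S. H p s \<in> \<alpha>}"
  have "closedin (top_of_set ?S) T"
  proof -
    have "T = ?S \<inter> ?C" by (auto simp: T_def)
    then show ?thesis using closed_trace[OF p] by (auto simp: closedin_closed)
  qed
  moreover have "openin (top_of_set ?S) T"
    unfolding openin_contains_ball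
  proof (intro conjI ballI)
    fix s assume s: "s \<in> T"
    then obtain t where t: "t \<in> {0..1}" "H p s = h t" by (auto simp: T_def)
    have "h t \<in> H p ` {0<..1/2}" using s t(2)[symmetric] by (simp add: T_def)
    then have "t \<noteq> 0" "t \<noteq> 1" using ends by metis+
    then have t': "0 < t" "t < 1" using t(1) by auto
    have s': "0 < s" "s \<le> 1/2" using s by (auto simp: T_def)
    \<comment> \<open>A window around \<open>s\<close> that stays inside the open edge. It reaches
      beyond 1/2, so that the midpoint too has a neighbourhood on both sides.\<close>
    have inj: "inj_on (H p) {s/2..(s+1)/2}" using s' by (intro half_edge_inj_on[OF p]) auto
    have c: "continuous_map (top_of_set {s/2..(s+1)/2}) X (H p)"
      using continuous_half_edge[OF p] by (rule continuous_map_from_subtopology_mono) (use s' in auto)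
    have o: "openin X (H p ` {s/2<..<(s+1)/2})"
      by (rule open_half_edge_part[OF p]) (use s' in auto)
    have sub: "H p ` {s/2<..<(s+1)/2} \<subseteq> H p ` {s/2..(s+1)/2}" by (intro image_mono) auto
    have hs: "h t \<in> H p ` {s/2<..<(s+1)/2}" using s' unfolding t(2)[symmetric] by (intro imageI) auto
    obtain x r y where xy: "s/2 \<le> x" "x < r" "r < y" "y \<le> (s+1)/2" "H p r = h t" "H p ` {x..y} \<subseteq> \<alpha>"
      using arc_crosses_open_subarc[OF Hausdorff arc_cont arc_inj c inj o sub t' hs] .
    have "r = s" using inj_onD[OF inj, of r s] xy t(2) s' by auto
    then have "ball s (min (s - x) (y - s)) \<subseteq> {x..y}"
      by (auto simp: dist_real_def)
    then have "ball s (min (s - x) (y - s)) \<inter> ?S \<subseteq> T"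
      using xy(6) by (auto simp only: T_def)
    then show "\<exists>e>0. ball s e \<inter> ?S \<subseteq> T"
      using xy \<open>r = s\<close> by (intro exI[of _ "min (s - x) (y - s)"]) auto
  qed (auto simp: T_def)
  moreover have "1/2 \<in> T" using mid by (simp add: T_def)
  moreover have "connected ?S" by simp
  ultimately have TS: "T = ?S" unfolding connected_clopen by blast
  have "?S \<subseteq> ?C"
  proof
    fix s assume "s \<in> ?S"
    then have "s \<in> T" using TS by simp
    then show "s \<in> ?C" by (simp add: T_def)
  qed
  \<comment> \<open>Connectedness reaches every positive parameter; the vertex at 0 is added because
    the trace is closed.\<close>
  then have "closure ?S \<subseteq> ?C" using closed_trace[OF p] by (rule closure_minimal)
  then show ?thesis by auto
qed

text \<open>An arc passing through the leaf at an interior time would cover edge parameters on both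
  sides of 0, by \<open>arc_crosses_open_subarc\<close>; there are none below 0.\<close>

lemma leaf_is_end:
  assumes p: "p \<in> half_edges" "incident (H p 0) = {p}" and "H p 0 \<in> \<alpha>"
  shows "H p 0 \<in> {h 0, h 1}"
proof (rule ccontr)
  assume "H p 0 \<notin> {h 0, h 1}"
  moreover obtain t where t: "t \<in> {0..1}" "H p 0 = h t" using assms(3) by auto
  ultimately have "t \<noteq> 0" "t \<noteq> 1" by auto
  then have t': "0 < t" "t < 1" using t(1) by auto
  have inj: "inj_on (H p) {0..1/2}" by (intro half_edge_inj_on[OF p(1)]) auto
  have c: "continuous_map (top_of_set {0..1/2}) X (H p)"
    using continuous_half_edge[OF p(1)] by (rule continuous_map_from_subtopology_mono) auto
  have o: "openin X (H p ` {0..<1/2})"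
    by (rule open_leaf_part[OF p]) auto
  have sub: "H p ` {0..<1/2} \<subseteq> H p ` {0..1/2}" by (intro image_mono) auto
  have hs: "h t \<in> H p ` {0..<1/2}" unfolding t(2)[symmetric] by (intro imageI) auto
  obtain x r y where xy: "0 \<le> x" "x < r" "r < y" "y \<le> 1/2" "H p r = h t"
    using arc_crosses_open_subarc[OF Hausdorff arc_cont arc_inj c inj o sub t' hs] .
  then show False using inj_onD[OF inj, of r 0] t(2) by auto
qed

text \<open>An arc contains no triod: two half-edges leaving \<open>v\<close> on the same side of the arc would overlap.\<close>

lemma card_covered_le_2:
  "card {p \<in> incident v. H p ` {0..1/2} \<subseteq> \<alpha>} \<le> 2"
proof -
  let ?A = "{p \<in> incident v. H p ` {0..1/2} \<subseteq> \<alpha>}"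
  have "homeomorphic_map unit_interval_topology (subtopology X \<alpha>) h"
    by (rule homeomorphic_map_onto_image[OF compact_space_interval Hausdorff arc_cont,
      unfolded topspace_euclidean_subtopology, OF arc_inj])
  then obtain k where k: "continuous_map (subtopology X \<alpha>) unit_interval_topology k"
    "\<And>s. s \<in> {0..1} \<Longrightarrow> k (h s) = s" "\<And>z. z \<in> topspace (subtopology X \<alpha>) \<Longrightarrow> h (k z) = z"
    unfolding homeomorphic_map_maps homeomorphic_maps_def by auto
  have hk: "h (k z) = z" if "z \<in> \<alpha>" for z using k(2) that by auto
  \<comment> \<open>The sample point lies before the midpoint so that it distinguishes the two
    half-edges of a loop: on \<open>flip p\<close> it has parameter 2/3, outside
    \<open>{0..1/2}\<close>.\<close>
  define r where "r p = k (H p (1/3))" for p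
  \<comment> \<open>\<open>k\<close> gives the position along the arc. The positions of the
    connected half-edge \<open>q\<close> contain everything between \<open>k v\<close> and
    \<open>r q\<close>, so the sample point of \<open>p\<close> lies on \<open>q\<close>.\<close>
  have between: "q = p" if pq: "p \<in> ?A" "q \<in> ?A" "r p \<in> {k v..r q} \<or> r p \<in> {r q..k v}" for p q
  proof -
    have p: "p \<in> half_edges" "H p ` {0..1/2} \<subseteq> \<alpha>" "H p 0 = v"
      and q: "q \<in> half_edges" "H q ` {0..1/2} \<subseteq> \<alpha>" "H q 0 = v"
      using pq by (auto simp: incident_def)
    have "continuous_map (top_of_set {0..1/2}) (subtopology X \<alpha>) (H q)"
      using continuous_map_from_subtopology_mono[OF continuous_half_edge[OF q(1)], of "{0..1/2}"] q(2)
      by (auto simp: continuous_map_in_subtopology image_subset_iff_funcset)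
    from continuous_map_compose[OF this k(1)]
    have "continuous_on {0..1/2} (k \<circ> H q)" by (simp add: continuous_map_in_subtopology)
    then have "connected ((k \<circ> H q) ` {0..1/2})" by (intro connected_continuous_image) auto
    moreover have "k v \<in> (k \<circ> H q) ` {0..1/2}" "r q \<in> (k \<circ> H q) ` {0..1/2}"
      using q(3) by (auto simp: r_def)
    ultimately have "r p \<in> (k \<circ> H q) ` {0..1/2}"
      using pq(3) connected_contains_Icc by (metis subsetD)
    then obtain s where s: "s \<in> {0..1/2}" "k (H p (1/3)) = k (H q s)" by (auto simp: r_def)
    have "H p (1/3) \<in> \<alpha>" "H q s \<in> \<alpha>" using p(2) q(2) s(1) by (auto simp: image_subset_iff)
    then have "H p (1/3) = H q s" using hk s(2) by metis
    then show "q = p" using half_edge_eqD[OF p(1) q(1), of "1/3" s] s(1) by auto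
  qed
  \<comment> \<open>The Boolean tells on which side of \<open>v\<close> the half-edge leaves. On the
    same side one of two sample points lies between \<open>v\<close> and the other.\<close>
  have "inj_on (\<lambda>p. k v \<le> r p) ?A"
  proof (rule inj_onI)
    fix p q assume pq: "p \<in> ?A" "q \<in> ?A" "(k v \<le> r p) = (k v \<le> r q)"
    then have "r p \<in> {k v..r q} \<or> r p \<in> {r q..k v} \<or> r q \<in> {k v..r p} \<or> r q \<in> {r p..k v}"
      by auto
    then show "p = q" using between[OF pq(1,2)] between[OF pq(2,1)] by blast
  qed
  then have "card ?A \<le> card (UNIV :: bool set)"
    by (intro card_inj_on_le[where f = "\<lambda>p. k v \<le> r p"]) auto
  then show ?thesis by simp
qed

lemma connectedin_arc: "connectedin X \<alpha>"
  using connectedin_continuous_map_image[OF arc_cont, of "{0..1}"] by (simp add: connectedin_subtopology)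

text \<open>Two missed points, one on each side of the midpoint, cut the edge at \<open>a\<close>
  and \<open>1 - b\<close>. The open part between them and the complement of its closed version
  would separate the arc, which contains the midpoint of \<open>p\<close> and that of another
  edge.\<close>

lemma both_halves_missing:
  assumes p: "p \<in> half_edges" "H p (1/2) \<in> \<alpha>" and q: "q \<in> half_edges" "H q (1/2) \<in> \<alpha>" "fst q \<noteq> fst p"
  shows "H p ` {0..1/2} \<subseteq> \<alpha> \<or> H (flip p) ` {0..1/2} \<subseteq> \<alpha>"
proof (rule ccontr)
  assume "\<not> ?thesis"
  then have *: "\<not> H p ` {0..1/2} \<subseteq> \<alpha>" "\<not> H (flip p) ` {0..1/2} \<subseteq> \<alpha>" by simp_all
  obtain a where "a \<in> {0..1/2}" "H p a \<notin> \<alpha>" using *(1) unfolding image_subset_iff by blast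
  moreover obtain b where "b \<in> {0..1/2}" "H (flip p) b \<notin> \<alpha>" using *(2) unfolding image_subset_iff by blast
  ultimately have ab: "a \<in> {0..1/2}" "b \<in> {0..1/2}" "H p a \<notin> \<alpha>" "H p (1 - b) \<notin> \<alpha>"
    by (simp_all add: half_edge_flip)
  have "1 - 1/2 = (1/2 :: real)" by simp
  then have "a \<noteq> 1/2" "b \<noteq> 1/2" using ab p(2) by metis+
  then have ab': "0 \<le> a" "a < 1/2" "0 \<le> b" "b < 1/2" using ab by auto
  let ?U = "H p ` {a<..<1-b}" and ?V = "topspace X - H p ` {a..1-b}"
  have "openin X ?U" using ab' by (intro open_half_edge_part p) auto
  moreover have "openin X ?V" using ab' closed_half_edge_part[OF p(1), of a "1 - b"] by auto
  moreover have "\<alpha> \<subseteq> ?U \<union> ?V"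
  proof
    fix x assume x: "x \<in> \<alpha>"
    have "x \<in> topspace X" using x closedin_subset[OF closed_arc] by auto
    moreover have "s \<in> {a<..<1-b}" if "s \<in> {a..1-b}" "x = H p s" for s
      using that x ab(3,4) by (metis atLeastAtMost_iff greaterThanLessThan_iff order_le_less)
    ultimately show "x \<in> ?U \<union> ?V" by blast
  qed
  moreover have "?U \<inter> ?V \<inter> \<alpha> = {}" by (auto intro: image_eqI)
  moreover have "H p (1/2) \<in> ?U" using ab' by (intro imageI) auto
  then have "?U \<inter> \<alpha> \<noteq> {}" using p(2) by blast
  moreover have "H q (1/2) \<in> ?V"
  proof -
    have False if "s \<in> {a..1-b}" "H q (1/2) = H p s" for s
      using half_edge_eqD[OF q(1) p(1), of "1/2" s] that ab' q(3) by auto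
    moreover have "H q (1/2) \<in> topspace X" using half_edge_in_topspace[OF q(1)] by simp
    ultimately show ?thesis by blast
  qed
  then have "?V \<inter> \<alpha> \<noteq> {}" using q(2) by blast
  ultimately show False using connectedin_arc unfolding connectedin by blast
qed

text \<open>Charge each half-edge of \<open>K\<close> that is not covered to an end of the arc at a
  parameter in \<open>{0<..1/2}\<close>, which exists by \<open>half_edge_covered\<close>. Such an
  end is no vertex, so it differs from the leaves in \<open>L\<close>, which are ends by
  \<open>leaf_is_end\<close>. Two half-edges could share a charge only as halves of one edge with
  the end at its midpoint, and \<open>both_halves_missing\<close> forbids this. Hence uncovered
  half-edges and leaves together number at most 2, and covered half-edges at most 2 per
  vertex.\<close>

lemma half_edge_count:
  assumes K: "K \<subseteq> half_edges" "\<And>p. p \<in> K \<Longrightarrow> H p (1/2) \<in> \<alpha>"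
    and two: "\<And>p. p \<in> K \<Longrightarrow> \<exists>q\<in>K. fst q \<noteq> fst p"
    and L: "\<And>v. v \<in> L \<Longrightarrow> v \<in> \<alpha> \<and> (\<exists>p\<in>half_edges. H p 0 = v \<and> incident v = {p})"
  shows "card K + card L \<le> 2 * card ((\<lambda>p. H p 0) ` K) + 2"
proof -
  have finK: "finite K" using K(1) finite_half_edges finite_subset by blast
  define M where "M = {p \<in> K. \<not> H p ` {0..1/2} \<subseteq> \<alpha>}"
  have "\<exists>e. e \<in> {h 0, h 1} \<and> e \<in> H p ` {0<..1/2}" if "p \<in> M" for p
    using half_edge_covered[of p] that K by (auto simp: M_def)
  then obtain e where e: "\<And>p. p \<in> M \<Longrightarrow> e p \<in> {h 0, h 1}" "\<And>p. p \<in> M \<Longrightarrow> e p \<in> H p ` {0<..1/2}"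
    by metis
  have "inj_on e M"
  proof (rule inj_onI, rule ccontr)
    fix p q assume pq: "p \<in> M" "q \<in> M" "e p = e q" "p \<noteq> q"
    obtain s where s: "s \<in> {0<..1/2}" "e p = H p s" using e(2)[OF pq(1)] by blast
    obtain t where t: "t \<in> {0<..1/2}" "e q = H q t" using e(2)[OF pq(2)] by blast
    have st: "s \<in> {0<..1/2}" "t \<in> {0<..1/2}" "H p s = H q t" using s t pq(3) by auto
    have "q = flip p"
      using half_edge_eqD[of p q s t] st pq K(1) by (auto simp: M_def)
    moreover obtain r where "r \<in> K" "fst r \<noteq> fst p" using two[of p] pq(1) by (auto simp: M_def)
    moreover have "p \<in> half_edges" "r \<in> half_edges" "H p (1/2) \<in> \<alpha>" "H r (1/2) \<in> \<alpha>"
      using K pq(1) \<open>r \<in> K\<close> by (auto simp: M_def)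
    ultimately show False
      using both_halves_missing[of p r] pq(1,2) by (simp add: M_def)
  qed
  moreover have L_ends: "L \<subseteq> {h 0, h 1}"
  proof
    fix v assume "v \<in> L"
    from L[OF this] obtain p where p: "p \<in> half_edges" "H p 0 = v" "incident v = {p}" and "v \<in> \<alpha>"
      by (elim conjE bexE)
    then show "v \<in> {h 0, h 1}" using leaf_is_end[OF p(1)] by metis
  qed
  moreover have "e p \<notin> L" if "p \<in> M" for p
  proof
    assume "e p \<in> L"
    then obtain q where q: "q \<in> half_edges" "H q 0 = e p" using L by blast
    obtain s where s: "s \<in> {0<..1/2}" "e p = H p s" using e(2) \<open>p \<in> M\<close> by blast
    show False using half_edge_eqD[of p q s 0] that K(1) q s by (auto simp: M_def)
  qed
  then have "e ` M \<inter> L = {}" by auto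
  moreover have "finite M" using finK by (simp add: M_def)
  moreover have "finite L" using L_ends finite_subset by blast
  ultimately have "card M + card L = card (e ` M \<union> L)"
    by (simp add: card_Un_disjoint card_image)
  also have "\<dots> \<le> card {h 0, h 1}" using e(1) L_ends by (intro card_mono) auto
  also have "\<dots> \<le> 2" by (simp add: card_insert_if)
  finally have M_L: "card M + card L \<le> 2" .
  have "K - M \<subseteq> (\<Union>v\<in>(\<lambda>p. H p 0) ` K. {p \<in> incident v. H p ` {0..1/2} \<subseteq> \<alpha>})"
    using K(1) by (auto simp: M_def incident_def)
  then have "card (K - M) \<le> card (\<Union>v\<in>(\<lambda>p. H p 0) ` K. {p \<in> incident v. H p ` {0..1/2} \<subseteq> \<alpha>})"
    using finK finite_incident by (intro card_mono) auto
  also have "\<dots> \<le> (\<Sum>v\<in>(\<lambda>p. H p 0) ` K. card {p \<in> incident v. H p ` {0..1/2} \<subseteq> \<alpha>})"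
    using finK by (intro card_UN_le) auto
  also have "\<dots> \<le> (\<Sum>v\<in>(\<lambda>p. H p 0) ` K. 2)" by (intro sum_mono card_covered_le_2)
  finally have "card (K - M) \<le> 2 * card ((\<lambda>p. H p 0) ` K)" by simp
  moreover have "card K = card (K - M) + card M"
    using finK by (simp add: M_def card_Diff_subset card_mono)
  ultimately show ?thesis using M_L by linarith
qed

end

section \<open>The counting inequality from n-arc connectedness\<close>

lemma n_arc_connected_finite_set:
  assumes "n_arc_connected n X" "finite F" "F \<noteq> {}" "card F \<le> n" "F \<subseteq> topspace X"
  shows "\<exists>A. arc_in X A \<and> F \<subseteq> A"
proof -
  obtain f where f: "bij_betw f {1..card F} F" using ex_bij_betw_nat_finite_1[OF assms(2)] by blast
  obtain x where x: "x \<in> F" using assms(3) by blast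
  \<comment> \<open>Surplus indices repeat a point of \<open>F\<close>, so fewer than
    \<open>n\<close> points are allowed.\<close>
  define p where "p i = (if i \<le> card F then f i else x)" for i
  have p: "p ` {1..n} = F"
  proof
    show "p ` {1..n} \<subseteq> F" using f x by (auto simp: p_def bij_betw_def)
    show "F \<subseteq> p ` {1..n}"
    proof
      fix y assume "y \<in> F"
      then obtain i where "i \<in> {1..card F}" "y = f i" using f by (metis bij_betw_def imageE)
      then show "y \<in> p ` {1..n}" using assms(4) by (auto simp: p_def intro!: image_eqI[of _ _ i])
    qed
  qed
  then have "\<forall>i \<in> {1..n}. p i \<in> topspace X" using assms(5) by blast
  then obtain A where "arc_in X A" "\<forall>i \<in> {1..n}. p i \<in> A"
    using assms(1) unfolding n_arc_connected_def by blast
  then show ?thesis using p by blast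
qed

text \<open>The prescribed points are one midpoint per edge met by \<open>K\<close> and the leaves
  in \<open>L\<close>. The requirement on \<open>n\<close> therefore counts edges, whereas the
  conclusion counts half-edges.\<close>

lemma (in arc_family) n_arc_connected_count:
  assumes n: "n_arc_connected n X"
    and K: "K \<subseteq> half_edges" and two: "\<And>p. p \<in> K \<Longrightarrow> \<exists>q\<in>K. fst q \<noteq> fst p" and "K \<noteq> {}"
    and L: "\<And>v. v \<in> L \<Longrightarrow> card (incident v) = 1"
    and le: "card (fst ` K) + card L \<le> n" and "finite L"
  shows "card K + card L \<le> 2 * card ((\<lambda>p. H p 0) ` K) + 2"
proof -
  have leaf: "\<exists>p\<in>half_edges. H p 0 = v \<and> incident v = {p}" if v: "v \<in> L" for v
  proof -
    obtain p where p: "incident v = {p}" using L[OF v] card_1_singletonE by blast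
    then have "p \<in> incident v" by simp
    then have "p \<in> half_edges" "H p 0 = v" unfolding incident_def by blast+
    then show ?thesis using p by blast
  qed
  have finK: "finite K" using K finite_half_edges finite_subset by blast
  define F where "F = (\<lambda>i. g i (1/2)) ` fst ` K \<union> L"
  have "finite F" using finK \<open>finite L\<close> by (simp add: F_def)
  moreover have "F \<noteq> {}" using \<open>K \<noteq> {}\<close> by (simp add: F_def)
  moreover have "card F \<le> n"
  proof -
    have "card F \<le> card ((\<lambda>i. g i (1/2)) ` fst ` K) + card L" unfolding F_def by (rule card_Un_le)
    also have "\<dots> \<le> card (fst ` K) + card L" using finK by (intro add_right_mono card_image_le) auto
    finally show ?thesis using le by simp
  qed
  moreover have "F \<subseteq> topspace X"
  proof -
    have "v \<in> topspace X" if v: "v \<in> L" for v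
    proof -
      obtain p where "p \<in> half_edges" "H p 0 = v" using leaf[OF v] by blast
      then show ?thesis using half_edge_in_topspace[of p 0] by simp
    qed
    moreover have "g (fst p) (1/2) \<in> topspace X" if "p \<in> K" for p
    proof -
      have "p \<in> half_edges" using that K by blast
      moreover have "H p (1/2) = g (fst p) (1/2)" by (simp add: half_edge_def)
      ultimately show ?thesis using half_edge_in_topspace[of p "1/2"] by simp
    qed
    ultimately show ?thesis by (auto simp: F_def)
  qed
  ultimately obtain A where A: "arc_in X A" "F \<subseteq> A"
    using n_arc_connected_finite_set[OF n] by blast
  obtain a b where "arc_in_with_ends X A a b" using A(1) unfolding arc_in_iff_ends by blast
  then obtain h where h: "continuous_map unit_interval_topology X h" "inj_on h {0..1}" "h ` {0..1} = A"
    by (rule arc_in_with_ends_param)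
  interpret arc_in_family X I g h
    by unfold_locales (use h in auto)
  show ?thesis
  proof (rule half_edge_count[OF K _ two])
    fix p assume "p \<in> K"
    then have "g (fst p) (1/2) \<in> A" using A(2) by (auto simp: F_def)
    then show "H p (1/2) \<in> h ` {0..1}" by (simp add: half_edge_def h(3))
  next
    fix v assume "v \<in> L"
    then show "v \<in> h ` {0..1} \<and> (\<exists>p\<in>half_edges. H p 0 = v \<and> incident v = {p})"
      using leaf A(2) h(3) by (auto simp: F_def)
  qed
qed

section \<open>Graphs as families of arcs\<close>

text \<open>The quotient map is closed, since saturating a closed set adds only finitely many end
  points. Closed continuous images of normal spaces are normal, and points of the quotient are
  closed, so it is normal and T1.\<close>

lemma Hausdorff_space_graph_quotient:
  fixes I :: "nat set"
  assumes I: "finite I"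
    and q: "quotient_map (sum_topology (\<lambda>_. unit_interval_topology) I) X q"
    and ends: "\<And>x y. x \<in> I \<times> {0..1} \<Longrightarrow> y \<in> I \<times> {0..1} \<Longrightarrow> q x = q y \<Longrightarrow>
      x = y \<or> (snd x \<in> {0, 1} \<and> snd y \<in> {0, 1})"
  shows "Hausdorff_space X"
proof -
  let ?S = "sum_topology (\<lambda>_. unit_interval_topology) I"
  have top: "topspace ?S = I \<times> {0..1}" by simp
  have surj: "q ` (I \<times> {0..1}) = topspace X"
    using quotient_imp_surjective_map[OF q] by simp
  have closed: "closed_map ?S X q"
    unfolding closed_map_def
  proof (intro allI impI)
    fix C assume C: "closedin ?S C"
    then have CI: "C \<subseteq> I \<times> {0..1}" using closedin_subset by fastforce
    \<comment> \<open>All end points glued to a point of \<open>C\<close>: by the hypothesis on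
      \<open>q\<close>, saturation adds nothing else.\<close>
    define F where "F = {x \<in> I \<times> {0, 1}. q x \<in> q ` C}"
    have preimage: "{x \<in> topspace ?S. q x \<in> q ` C} = C \<union> F"
    proof
      show "{x \<in> topspace ?S. q x \<in> q ` C} \<subseteq> C \<union> F"
      proof
        fix x assume "x \<in> {x \<in> topspace ?S. q x \<in> q ` C}"
        then obtain y where y: "x \<in> I \<times> {0..1}" "y \<in> C" "q x = q y" by auto
        then have "x = y \<or> snd x \<in> {0, 1}" using ends[of x y] CI by blast
        then show "x \<in> C \<union> F" using y by (auto simp: F_def mem_Times_iff)
      qed
      show "C \<union> F \<subseteq> {x \<in> topspace ?S. q x \<in> q ` C}"
        using CI by (auto simp: F_def)
    qed
    have "closedin ?S F"
    proof -
      have "finite {x. (i, x) \<in> F}" for i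
        by (rule finite_subset[of _ "{0, 1}"]) (auto simp: F_def)
      moreover have "F \<subseteq> Sigma I (topspace \<circ> (\<lambda>_. unit_interval_topology))" by (auto simp: F_def)
      moreover have "{x. (i, x) \<in> F} \<subseteq> {0..1}" for i by (auto simp: F_def)
      ultimately show ?thesis
        by (auto simp: closedin_sum_topology intro!: closed_subset finite_imp_closed)
    qed
    then have "closedin ?S {x \<in> topspace ?S. q x \<in> q ` C}"
      unfolding preimage using C by (rule closedin_Un[rotated])
    moreover have "q ` C \<subseteq> topspace X" using CI surj by blast
    ultimately show "closedin X (q ` C)"
      using q by (simp add: quotient_map_closedin)
  qed
  have "normal_space ?S"
    unfolding normal_space_def
  proof (intro allI impI)
    fix C D assume CD: "closedin ?S C \<and> closedin ?S D \<and> disjnt C D"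
    have N: "normal_space unit_interval_topology"
      by (simp add: metrizable_imp_normal_space metrizable_space_euclidean metrizable_space_subtopology)
    have "\<exists>U V. openin unit_interval_topology U \<and> openin unit_interval_topology V \<and>
        {x. (i, x) \<in> C} \<subseteq> U \<and> {x. (i, x) \<in> D} \<subseteq> V \<and> disjnt U V" if "i \<in> I" for i
    proof -
      have "closedin unit_interval_topology {x. (i, x) \<in> C}" "closedin unit_interval_topology {x. (i, x) \<in> D}"
        using CD that by (auto simp: closedin_sum_topology)
      moreover have "disjnt {x. (i, x) \<in> C} {x. (i, x) \<in> D}" using CD by (auto simp: disjnt_iff)
      ultimately show ?thesis using N unfolding normal_space_def by blast
    qed
    then obtain U V where UV: "\<And>i. i \<in> I \<Longrightarrow> openin unit_interval_topology (U i)"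
      "\<And>i. i \<in> I \<Longrightarrow> openin unit_interval_topology (V i)"
      "\<And>i. i \<in> I \<Longrightarrow> {x. (i, x) \<in> C} \<subseteq> U i" "\<And>i. i \<in> I \<Longrightarrow> {x. (i, x) \<in> D} \<subseteq> V i"
      "\<And>i. i \<in> I \<Longrightarrow> disjnt (U i) (V i)"
      by metis
    have "openin ?S (Sigma I U)" "openin ?S (Sigma I V)"
      using UV(1,2) by (simp_all add: openin_disjoint_union)
    moreover have "C \<subseteq> I \<times> {0..1}" "D \<subseteq> I \<times> {0..1}"
      using CD closedin_subset top by metis+
    then have "C \<subseteq> Sigma I U" "D \<subseteq> Sigma I V"
      using UV(3,4) by blast+
    moreover have "disjnt (Sigma I U) (Sigma I V)"
      using UV(5) by (auto simp: disjnt_iff)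
    ultimately show "\<exists>U V. openin ?S U \<and> openin ?S V \<and> C \<subseteq> U \<and> D \<subseteq> V \<and> disjnt U V"
      by blast
  qed
  then have "normal_space X"
    using quotient_imp_continuous_map[OF q] closed quotient_imp_surjective_map[OF q]
    by (rule normal_space_continuous_closed_map_image)
  moreover have "t1_space X"
    unfolding t1_space_closedin_singleton
  proof
    fix y assume "y \<in> topspace X"
    then have "y \<in> q ` (I \<times> {0..1})" using surj by simp
    then obtain i s where y: "i \<in> I" "s \<in> {0..1}" "y = q (i, s)" by auto
    have "closedin unit_interval_topology {x. (j, x) \<in> {(i, s)}}" if "j \<in> I" for j
      using y by (cases "j = i") (auto intro!: closed_subset)
    then have "closedin ?S {(i, s)}"
      using y by (simp add: closedin_sum_topology)
    then have "closedin X (q ` {(i, s)})" using closed unfolding closed_map_def by blast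
    then show "closedin X {y}" using y by simp
  qed
  ultimately show ?thesis using normal_t1_eq_Hausdorff_space by blast
qed

lemma graph_space_arc_family:
  assumes "graph_space X"
  obtains I g where "arc_family X I g"
proof -
  obtain n :: nat and q where "n > 0"
    and q: "quotient_map (sum_topology (\<lambda>_. unit_interval_topology) {..<n}) X q"
    and ends: "\<forall>x \<in> {..<n} \<times> {0..1}. \<forall>y \<in> {..<n} \<times> {0..1}.
           q x = q y \<longrightarrow> x = y \<or> (snd x \<in> {0, 1} \<and> snd y \<in> {0, 1})"
    using assms unfolding graph_space_def by blast
  have "arc_family X {..<n} (\<lambda>i s. q (i, s))"
  proof
    show "Hausdorff_space X"
    proof (rule Hausdorff_space_graph_quotient[OF _ q])
      show "x = y \<or> snd x \<in> {0, 1} \<and> snd y \<in> {0, 1}"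
        if "x \<in> {..<n} \<times> {0..1}" "y \<in> {..<n} \<times> {0..1}" "q x = q y" for x y
        using ends[rule_format, OF that] .
    qed simp
    show "connected_space X" using assms by (simp add: graph_space_def)
    show "{..<n} \<noteq> {}" using \<open>n > 0\<close> by auto
    show "continuous_map unit_interval_topology X (\<lambda>s. q (i, s))" if "i \<in> {..<n}" for i
      using continuous_map_compose[OF continuous_map_component_injection[OF that]
          quotient_imp_continuous_map[OF q]] by (simp add: o_def)
    show "topspace X = (\<Union>i\<in>{..<n}. (\<lambda>s. q (i, s)) ` {0..1})"
    proof -
      have "topspace X = q ` ({..<n} \<times> {0..1})" using quotient_imp_surjective_map[OF q] by simp
      also have "\<dots> = (\<Union>i\<in>{..<n}. (\<lambda>s. q (i, s)) ` {0..1})" by auto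
      finally show ?thesis .
    qed
    show "i = j \<and> s = t \<or> s \<in> {0, 1} \<and> t \<in> {0, 1}"
      if "i \<in> {..<n}" "j \<in> {..<n}" "s \<in> {0..1}" "t \<in> {0..1}" "q (i, s) = q (j, t)" for i j s t
      using ends[rule_format, of "(i, s)" "(j, t)"] that by auto
  qed simp
  then show thesis by (rule that)
qed

section \<open>Connectedness along edges and merging at vertices of degree 2\<close>

context arc_family
begin

lemma two_points: "\<exists>x\<in>topspace X. \<exists>y\<in>topspace X. x \<noteq> y"
proof -
  obtain i where i: "i \<in> I" using nonempty_I by blast
  have "g i (1/2) \<noteq> g i (1/3)" using only_ends[OF i i, of "1/2" "1/3"] by auto
  moreover have "g i (1/2) \<in> topspace X" "g i (1/3) \<in> topspace X"
    using continuous_map_image_subset_topspace[OF cont[OF i]] by (auto simp: image_subset_iff)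
  ultimately show ?thesis by blast
qed

text \<open>Topological connectedness in the form of an induction along edges. Edges with ends in
  \<open>S\<close> and edges with ends outside \<open>S\<close> form two closed unions; they are
  disjoint because distinct edges meet only at vertices.\<close>

lemma vertices_connected:
  assumes p0: "p0 \<in> half_edges" "H p0 0 \<in> S"
    and step: "\<And>p. p \<in> half_edges \<Longrightarrow> H p 0 \<in> S \<Longrightarrow> H (flip p) 0 \<in> S"
    and q: "q \<in> half_edges"
  shows "H q 0 \<in> S"
proof -
  define J where "J = {i \<in> I. H (i, False) 0 \<in> S}"
  have J: "fst p \<in> J \<longleftrightarrow> H p 0 \<in> S" if "p \<in> half_edges" for p
    using that step[of p] step[of "flip p"] by (cases p; cases "snd p") (auto simp: J_def flip_def)
  let ?E = "\<lambda>J. \<Union>i\<in>J. g i ` {0..1}"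
  have "closedin X (?E J)" "closedin X (?E (I - J))"
    by (rule closed_edges; auto simp: J_def)+
  moreover have "topspace X \<subseteq> ?E J \<union> ?E (I - J)"
    unfolding cover by (auto simp: J_def)
  moreover have "?E J \<inter> ?E (I - J) = {}"
  proof -
    have False if ij: "i \<in> J" "j \<in> I - J" "s \<in> {0..1}" "t \<in> {0..1}" "g i s = g j t" for i j s t
    proof -
      have "i \<in> I" "j \<in> I" "i \<noteq> j" using ij by (auto simp: J_def)
      then have "s \<in> {0, 1}" "t \<in> {0, 1}" using only_ends[of i j s t] ij by auto
      then have "H (i, s = 1) 0 = H (j, t = 1) 0" using ij(5) by (auto simp: half_edge_def)
      then show False using J[of "(i, s = 1)"] J[of "(j, t = 1)"] ij \<open>i \<in> I\<close> by auto
    qed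
    then show ?thesis by blast
  qed
  moreover have "fst p0 \<in> J" using J p0 by blast
  then have "?E J \<noteq> {}" by auto
  ultimately have "?E (I - J) = {}"
    using connected[unfolded connected_space_closedin, simplified, rule_format, of "?E J" "?E (I - J)"]
    by simp
  then have "I \<subseteq> J" by auto
  then show ?thesis using J q by (metis mem_Times_iff subsetD)
qed

text \<open>Running along \<open>p\<close> backwards and then along \<open>q\<close> makes
  \<open>v\<close> an interior point of one new edge, which takes over the index of
  \<open>p\<close>. As \<open>p\<close> and \<open>q\<close> belong to different edges and nothing
  else starts at \<open>v\<close>, neither edge is a loop, so the new edge visits \<open>v\<close>
  only once. Its own two ends may coincide.\<close>

lemma merge_edges:
  assumes pq: "incident v = {p, q}" "fst p \<noteq> fst q"
  shows "\<exists>f. arc_family X (I - {fst q}) f"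
proof -
  have p: "p \<in> half_edges" "H p 0 = v" and q: "q \<in> half_edges" "H q 0 = v"
    using pq(1) unfolding incident_def by blast+
  have at_v: "r = p \<or> r = q" if "r \<in> half_edges" "H r 0 = v" for r
    using that pq(1) unfolding incident_def by blast
  have not_v: "H (flip p) 0 \<noteq> v" "H (flip q) 0 \<noteq> v"
    using at_v[of "flip p"] at_v[of "flip q"] p q pq(2) by (auto simp: flip_def)
  have fp: "flip p \<in> half_edges" using p by simp
  \<comment> \<open>Double speed: the far end of \<open>p\<close> is at 0, \<open>v\<close> at 1/2
    and the far end of \<open>q\<close> at 1.\<close>
  define G where "G s = (if s \<le> 1/2 then H (flip p) (2 * s) else H q (2 * s - 1))" for s
  have G_v: "s = 1/2" if s: "s \<in> {0..1}" "G s = v" for s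
  proof (cases "s \<le> 1/2")
    case True
    then have "H p (1 - 2 * s) = H p 0" using s p by (simp add: G_def half_edge_flip)
    moreover have "s \<noteq> 0" using s not_v by (auto simp: G_def)
    ultimately show ?thesis using half_edge_eqD[OF p(1) p(1), of "1 - 2 * s" 0] s True by auto
  next
    case False
    then have "H q (2 * s - 1) = H q 0" using s q by (simp add: G_def)
    moreover have "s \<noteq> 1" using s not_v by (auto simp: G_def half_edge_flip)
    ultimately show ?thesis using half_edge_eqD[OF q(1) q(1), of "2 * s - 1" 0] s False by auto
  qed
  have G_other: "s \<in> {0, 1} \<and> t \<in> {0, 1}"
    if r: "r \<in> half_edges" "fst r \<noteq> fst p" "fst r \<noteq> fst q" "s \<in> {0..1}" "t \<in> {0..1}" "G s = H r t" for r s t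
  proof -
    have ne: "r \<noteq> flip p" "r \<noteq> p" "r \<noteq> q" "r \<noteq> flip q" using r(2,3) by auto
    have "t \<in> {0, 1} \<and> (s \<in> {0, 1} \<or> s = 1/2)"
    proof (cases "s \<le> 1/2")
      case True
      then have "H (flip p) (2 * s) = H r t" using r by (simp add: G_def)
      then show ?thesis using half_edge_eqD[OF fp r(1), of "2 * s" t] r(4,5) True ne by auto
    next
      case False
      then have "H q (2 * s - 1) = H r t" using r by (simp add: G_def)
      then show ?thesis using half_edge_eqD[OF q(1) r(1), of "2 * s - 1" t] r(4,5) False ne by auto
    qed
    \<comment> \<open>Otherwise another edge would end at \<open>v\<close> and supply a third
      half-edge there.\<close>
    moreover have "s \<noteq> 1/2" if "t \<in> {0, 1}"
    proof
      assume "s = 1/2"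
      moreover have "G (1/2) = v" using p by (simp add: G_def half_edge_flip)
      ultimately have "G s = v" by (simp only:)
      then have "H (if t = 0 then r else flip r) 0 = v"
        using that r(6) by (auto simp: half_edge_flip)
      then show False using at_v[of "if t = 0 then r else flip r"] r(1-3) by (auto split: if_splits)
    qed
    ultimately show ?thesis by blast
  qed
  have G_inj_le: "s = t \<or> (s \<in> {0, 1} \<and> t \<in> {0, 1})"
    if st: "s \<in> {0..1}" "t \<in> {0..1}" "G s = G t" "s \<le> t" for s t
  proof -
    have "G (1/2) = v" using p by (simp add: G_def half_edge_flip)
    then have v: "s = 1/2 \<longleftrightarrow> t = 1/2" using G_v[of s] G_v[of t] st(1-3) by metis
    consider "t \<le> 1/2" | "s > 1/2" | "s \<le> 1/2" "t > 1/2" using st by linarith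
    then show ?thesis
    proof cases
      case 1
      then have "H (flip p) (2 * s) = H (flip p) (2 * t)" using st by (simp add: G_def)
      then show ?thesis using half_edge_eqD[OF fp fp, of "2 * s" "2 * t"] st 1 v
        by (auto simp: eq_commute[of "flip p"])
    next
      case 2
      then have "H q (2 * s - 1) = H q (2 * t - 1)" using st by (simp add: G_def)
      then show ?thesis using half_edge_eqD[OF q(1) q(1), of "2 * s - 1" "2 * t - 1"] st 2 v
        by (auto simp: eq_commute[of q])
    next
      case 3
      then have "H (flip p) (2 * s) = H q (2 * t - 1)" using st by (simp add: G_def)
      moreover have "q \<noteq> flip p" "q \<noteq> p" using pq(2) by auto
      ultimately show ?thesis using half_edge_eqD[OF fp q(1), of "2 * s" "2 * t - 1"] st 3 v by auto
    qed
  qed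
  have G_inj: "s = t \<or> (s \<in> {0, 1} \<and> t \<in> {0, 1})" if "s \<in> {0..1}" "t \<in> {0..1}" "G s = G t" for s t
    using G_inj_le[of s t] G_inj_le[of t s] that by fastforce
  have G_cont: "continuous_map unit_interval_topology X G"
    unfolding G_def[abs_def]
  proof (rule continuous_map_join)
    show "continuous_map (top_of_set {0..1/2}) X (\<lambda>s. H (flip p) (2 * s))"
      by (rule continuous_map_reparametrize[OF continuous_half_edge[OF fp]]) (auto intro!: continuous_intros)
    show "continuous_map (top_of_set {1/2..1}) X (\<lambda>s. H q (2 * s - 1))"
      by (rule continuous_map_reparametrize[OF continuous_half_edge[OF q(1)]]) (auto intro!: continuous_intros)
    show "H (flip p) (2 * (1/2)) = H q (2 * (1/2) - 1)" using p q by (simp add: half_edge_flip)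
  qed
  have G_cover: "g (fst p) ` {0..1} \<union> g (fst q) ` {0..1} \<subseteq> G ` {0..1}"
  proof -
    have "H (flip p) s = G (s / 2)" "s / 2 \<in> {0..1}" if "s \<in> {0..1}" for s
      using that by (auto simp: G_def)
    then have "H (flip p) ` {0..1} \<subseteq> G ` {0..1}" by (metis image_subsetI imageI)
    moreover have "H q s = G ((s + 1) / 2)" "(s + 1) / 2 \<in> {0..1}" if "s \<in> {0..1}" for s
      using that p q by (auto simp: G_def half_edge_flip field_simps)
    then have "H q ` {0..1} \<subseteq> G ` {0..1}" by (metis image_subsetI imageI)
    ultimately show ?thesis by (simp add: half_edge_image)
  qed
  have "arc_family X (I - {fst q}) (g(fst p := G))"
  proof
    show "finite (I - {fst q})" using finite_I by simp
    show "I - {fst q} \<noteq> {}" using p(1) pq(2) by auto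
    show "continuous_map unit_interval_topology X ((g(fst p := G)) i)" if "i \<in> I - {fst q}" for i
      using that cont G_cont by simp
    show "topspace X = (\<Union>i\<in>I - {fst q}. (g(fst p := G)) i ` {0..1})"
    proof
      show "(\<Union>i\<in>I - {fst q}. (g(fst p := G)) i ` {0..1}) \<subseteq> topspace X"
      proof (rule UN_least)
        fix i assume "i \<in> I - {fst q}"
        then show "(g(fst p := G)) i ` {0..1} \<subseteq> topspace X"
          using continuous_map_image_subset_topspace[OF G_cont]
            continuous_map_image_subset_topspace[OF cont[of i]] by auto
      qed
      show "topspace X \<subseteq> (\<Union>i\<in>I - {fst q}. (g(fst p := G)) i ` {0..1})"
      proof
        fix x assume "x \<in> topspace X"
        then obtain i where i: "i \<in> I" "x \<in> g i ` {0..1}" using cover by auto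
        show "x \<in> (\<Union>i\<in>I - {fst q}. (g(fst p := G)) i ` {0..1})"
        proof (cases "i = fst p \<or> i = fst q")
          case True
          then have "x \<in> (g(fst p := G)) (fst p) ` {0..1}" using i G_cover by auto
          moreover have "fst p \<in> I - {fst q}" using p(1) pq(2) by auto
          ultimately show ?thesis by blast
        next
          case False
          then have "x \<in> (g(fst p := G)) i ` {0..1}" "i \<in> I - {fst q}" using i by auto
          then show ?thesis by blast
        qed
      qed
    qed
    fix i j s t
    assume ij: "i \<in> I - {fst q}" "j \<in> I - {fst q}" "s \<in> {0..1}" "t \<in> {0..1}"
      and eq: "(g(fst p := G)) i s = (g(fst p := G)) j t"
    consider "i = fst p" "j = fst p" | "i = fst p" "j \<noteq> fst p" | "i \<noteq> fst p" "j = fst p"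
      | "i \<noteq> fst p" "j \<noteq> fst p" by blast
    then show "i = j \<and> s = t \<or> s \<in> {0, 1} \<and> t \<in> {0, 1}"
    proof cases
      case 1
      then show ?thesis using G_inj[of s t] ij eq by auto
    next
      case 2
      then show ?thesis using G_other[of "(j, False)" s t] ij eq by (auto simp: half_edge_def)
    next
      case 3
      then show ?thesis using G_other[of "(i, False)" t s] ij eq by (auto simp: half_edge_def)
    next
      case 4
      then show ?thesis using only_ends[of i j s t] ij eq by auto
    qed
  qed (use Hausdorff connected in auto)
  then show ?thesis by blast
qed

end

section \<open>Classification by degrees\<close>

locale reduced_arc_family = arc_family X I g for X :: "'a topology" and I g +
  assumes minimal: "\<And>J f. arc_family X J f \<Longrightarrow> card I \<le> card J"
begin

text \<open>Merging two different edges at \<open>v\<close> would give a presentation with fewer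
  edges. So a vertex of degree 2 carries a loop.\<close>

lemma incident_doubleton:
  assumes "incident v = {p, q}" "p \<noteq> q"
  shows "q = flip p"
proof (rule ccontr)
  assume "q \<noteq> flip p"
  then have "fst p \<noteq> fst q" using assms(2) same_edge_iff by metis
  then obtain f where "arc_family X (I - {fst q}) f" using merge_edges[OF assms(1)] by blast
  then have "card I \<le> card (I - {fst q})" by (rule minimal)
  moreover have "q \<in> half_edges" using assms(1) unfolding incident_def by blast
  then have "fst q \<in> I" by (simp add: mem_Times_iff)
  then have "card (I - {fst q}) < card I" by (rule card_Diff1_less[OF finite_I])
  ultimately show False by simp
qed

end

context arc_family
begin

lemma card_half_edges: "card half_edges = 2 * card I"
  by (simp add: card_cartesian_product)

lemma edge_is_arc:
  assumes p: "p \<in> half_edges" and ne: "H p 0 \<noteq> H (flip p) 0"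
  shows "arc_in_with_ends X (g (fst p) ` {0..1}) (H p 0) (H (flip p) 0)"
proof -
  have "inj_on (H p) {0..1}"
  proof (rule inj_onI)
    fix s t assume st: "s \<in> {0..1}" "t \<in> {0..1}" "H p s = H p t"
    have "p \<noteq> flip p" using flip_simps(4) by metis
    then have "s = t \<or> (s \<in> {0, 1} \<and> t \<in> {0, 1})" using half_edge_eqD[OF p p st] by blast
    then show "s = t" using ne st(3) by (auto simp: half_edge_flip)
  qed
  from arc_in_with_ends_image[OF Hausdorff continuous_half_edge[OF p] this]
  show ?thesis by (simp add: half_edge_image half_edge_flip)
qed

lemma edge_is_loop:
  assumes p: "p \<in> half_edges" and eq: "H p 0 = H (flip p) 0"
  shows "simple_closed_curve_in X (g (fst p) ` {0..1})"
proof -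
  have "simple_closed_curve_in X (H p ` {0..1})"
  proof (rule simple_closed_curve_in_image[OF Hausdorff continuous_half_edge[OF p]])
    show "H p 0 = H p 1" using eq by (simp add: half_edge_flip)
    fix s t assume st: "s \<in> {0..1}" "t \<in> {0..1}" "H p s = H p t"
    have "p \<noteq> flip p" using flip_simps(4) by metis
    then show "s = t \<or> {s, t} = {0, 1}" using half_edge_eqD[OF p p st] by (auto simp: doubleton_eq_iff)
  qed
  then show ?thesis by (simp add: half_edge_image)
qed

lemma edges_meet:
  assumes "p \<in> half_edges" "q \<in> half_edges" "fst p \<noteq> fst q"
  shows "g (fst p) ` {0..1} \<inter> g (fst q) ` {0..1} = {H p 0, H (flip p) 0} \<inter> {H q 0, H (flip q) 0}"
proof -
  have ends: "{H r 0, H (flip r) 0} = g (fst r) ` {0, 1}" for r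
    by (auto simp: half_edge_def)
  have ij: "fst p \<in> I" "fst q \<in> I" using assms by auto
  have "x \<in> g (fst p) ` {0, 1} \<inter> g (fst q) ` {0, 1}"
    if "x \<in> g (fst p) ` {0..1}" "x \<in> g (fst q) ` {0..1}" for x
  proof -
    obtain s t where st: "s \<in> {0..1}" "t \<in> {0..1}" "x = g (fst p) s" "x = g (fst q) t"
      using \<open>x \<in> g (fst p) ` {0..1}\<close> \<open>x \<in> g (fst q) ` {0..1}\<close> by blast
    then have "s \<in> {0, 1} \<and> t \<in> {0, 1}" using only_ends[OF ij st(1,2)] assms(3) by metis
    then show ?thesis using st(3,4) by blast
  qed
  moreover have "g i ` {0, 1} \<subseteq> g i ` {0..1}" for i by (intro image_mono) auto
  ultimately show ?thesis unfolding ends by blast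
qed

lemma exists_other_edge:
  fixes K :: "(nat \<times> bool) set" and p :: "nat \<times> bool"
  assumes "card K \<ge> 3"
  shows "\<exists>q\<in>K. fst q \<noteq> fst p"
proof (rule ccontr)
  assume "\<not> ?thesis"
  then have same: "fst q = fst p" if "q \<in> K" for q using that by blast
  have "K \<subseteq> {p, flip p}"
  proof
    fix q assume "q \<in> K"
    then show "q \<in> {p, flip p}" using same[of q] same_edge_iff[of p q] by simp
  qed
  then have "card K \<le> card {p, flip p}" by (intro card_mono) auto
  also have "\<dots> \<le> 2" by (simp add: card_insert_if)
  finally show False using assms by simp
qed

lemma single_edge:
  assumes p: "p \<in> half_edges" and all: "half_edges \<subseteq> {p, flip p}"
  shows "topspace X = g (fst p) ` {0..1}"
proof -
  have "i = fst p" if "i \<in> I" for i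
  proof -
    have "(i, False) \<in> {p, flip p}" using that all by blast
    then show ?thesis by (auto simp: flip_def)
  qed
  moreover have "fst p \<in> I" using p by (simp add: mem_Times_iff)
  ultimately have "I = {fst p}" by blast
  then show ?thesis using cover by simp
qed

end

lemma card_3_other_elements:
  assumes "finite S" "card S = 3" "x \<in> S"
  obtains y z where "S = {x, y, z}" "x \<noteq> y" "x \<noteq> z" "y \<noteq> z"
proof -
  have "card (S - {x}) = 2" using assms by simp
  then obtain y z where "S - {x} = {y, z}" "y \<noteq> z" by (auto simp: card_2_iff)
  then show thesis using assms(3) by (intro that[of y z]) auto
qed

section \<open>Degrees in a 7-arc-connected graph\<close>

locale seven_ac_family = reduced_arc_family X I g for X :: "'a topology" and I g +
  assumes seven_ac: "n_arc_connected 7 X"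
begin

abbreviation "vertices \<equiv> (\<lambda>p. H p 0) ` half_edges"
abbreviation "deg v \<equiv> card (incident v)"

text \<open>Three half-edges never fit on one edge, so \<open>K\<close> meets two edges.
  \<open>W\<close> lets the vertices be listed explicitly, in place of the image of
  \<open>K\<close>.\<close>

lemma seven_ac_count:
  assumes K: "K \<subseteq> half_edges" "card K \<ge> 3" and W: "(\<lambda>p. H p 0) ` K \<subseteq> W" "finite W"
    and L: "\<And>v. v \<in> L \<Longrightarrow> deg v = 1" "finite L" and le: "card (fst ` K) + card L \<le> 7"
  shows "card K + card L \<le> 2 * card W + 2"
proof -
  have "card K + card L \<le> 2 * card ((\<lambda>p. H p 0) ` K) + 2"
    by (rule n_arc_connected_count[OF seven_ac K(1)])
      (use exists_other_edge[OF K(2)] K(2) L le in auto)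
  also have "\<dots> \<le> 2 * card W + 2" using W by (simp add: card_mono)
  finally show ?thesis .
qed

lemma incident_subset: "incident v \<subseteq> half_edges"
  by (auto simp: incident_def)

lemma incident_vertex: "(\<lambda>p. H p 0) ` incident v \<subseteq> {v}"
  by (auto simp: incident_def)

lemma incident_disjoint: "v \<noteq> w \<Longrightarrow> incident v \<inter> incident w = {}"
  by (auto simp: incident_def)

lemma deg_pos: "v \<in> vertices \<Longrightarrow> deg v \<ge> 1"
  using finite_incident[of v] by (auto simp: incident_def Suc_le_eq card_gt_0_iff)

text \<open>Five half-edges at one vertex exceed \<open>2 * 1 + 2\<close>. Selecting exactly five
  keeps the number of marked points below seven, however large the degree.\<close>

lemma deg_le_4: "deg v \<le> 4"
proof (rule ccontr)
  assume "\<not> ?thesis"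
  then have "5 \<le> card (incident v)" by simp
  then obtain K where K: "K \<subseteq> incident v" "card K = 5" "finite K"
    by (rule obtain_subset_with_card_n)
  have "card K + card ({} :: 'a set) \<le> 2 * card {v} + 2"
  proof (rule seven_ac_count)
    show "K \<subseteq> half_edges" using K incident_subset by blast
    show "(\<lambda>p. H p 0) ` K \<subseteq> {v}" using K incident_vertex by blast
    show "card (fst ` K) + card ({} :: 'a set) \<le> 7" using K card_image_le[of K fst] by simp
  qed (use K in auto)
  then show False using K by simp
qed

lemma deg_two_loop:
  assumes "deg v = 2"
  obtains p where "p \<in> half_edges" "incident v = {p, flip p}"
proof -
  obtain p q where pq: "incident v = {p, q}" "p \<noteq> q" using assms by (auto simp: card_2_iff)
  then have "p \<in> incident v" by simp
  then have "p \<in> half_edges" using incident_subset by blast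
  then show thesis using that pq incident_doubleton[OF pq] by metis
qed

text \<open>No edge leads away from the vertex of a loop that carries nothing else, so by
  connectedness the loop is the whole space.\<close>

lemma deg_two_circle:
  assumes "deg v = 2"
  shows "is_simple_closed_curve X"
proof -
  obtain p where p: "p \<in> half_edges" "incident v = {p, flip p}"
    using assms by (rule deg_two_loop)
  then have v: "H p 0 = v" "H (flip p) 0 = v" unfolding incident_def by blast+
  have step: "H (flip q) 0 \<in> {v}" if "q \<in> half_edges" "H q 0 \<in> {v}" for q
  proof -
    have "q \<in> incident v" using that by (simp add: incident_def)
    then show ?thesis using p v by auto
  qed
  have "q \<in> incident v" if "q \<in> half_edges" for q
    using vertices_connected[OF p(1), of "{v}" q] v step that by (auto simp: incident_def)
  then have "half_edges \<subseteq> {p, flip p}" using p(2) by blast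
  then have "topspace X = g (fst p) ` {0..1}" by (rule single_edge[OF p(1)])
  then show ?thesis using edge_is_loop[OF p(1)] v by (simp add: is_simple_closed_curve_def)
qed

text \<open>From either end of an edge the only way to go is along that edge, so by connectedness
  there is just one. A loop would give its vertex degree 2.\<close>

lemma all_leaves_arc:
  assumes "\<And>v. v \<in> vertices \<Longrightarrow> deg v = 1"
  shows "is_arc X"
proof -
  obtain p where p: "p \<in> half_edges" using nonempty_I by auto
  have leaf: "q = r" if "q \<in> half_edges" "r \<in> half_edges" "H q 0 = H r 0" for q r
  proof -
    have "card (incident (H q 0)) = 1" using assms that by blast
    then obtain a where "incident (H q 0) = {a}" using card_1_singletonE by blast
    moreover have "q \<in> incident (H q 0)" "r \<in> incident (H q 0)" using that by (auto simp: incident_def)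
    ultimately show ?thesis by simp
  qed
  have step: "H (flip q) 0 \<in> {H p 0, H (flip p) 0}" if "q \<in> half_edges" "H q 0 \<in> {H p 0, H (flip p) 0}" for q
  proof -
    have "q = p \<or> q = flip p" using that leaf[of q p] leaf[of q "flip p"] p by auto
    then show ?thesis by auto
  qed
  have "q = p \<or> q = flip p" if "q \<in> half_edges" for q
  proof -
    have "H q 0 \<in> {H p 0, H (flip p) 0}"
      by (rule vertices_connected[OF p _ step that]) auto
    then show ?thesis using that leaf[of q p] leaf[of q "flip p"] p by auto
  qed
  then have "half_edges \<subseteq> {p, flip p}" by blast
  then have "topspace X = g (fst p) ` {0..1}" by (rule single_edge[OF p])
  moreover have "H p 0 \<noteq> H (flip p) 0" using leaf[of p "flip p"] p by (metis flip_in flip_simps(4))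
  ultimately show ?thesis
    using edge_is_arc[OF p] arc_in_iff_ends unfolding is_arc_def by metis
qed

text \<open>Degree 4 already exhausts the bound for one vertex. A leaf in addition gives
  \<open>4 + 1 > 2 * 1 + 2\<close>, and three half-edges at a second vertex give
  \<open>4 + 3 > 2 * 2 + 2\<close>.\<close>

lemma deg_four_only:
  assumes u: "deg u = 4" and w: "w \<in> vertices" "deg w \<noteq> 2"
  shows "w = u"
proof (rule ccontr)
  assume "w \<noteq> u"
  have fst_le: "card (fst ` K) \<le> card K" if "finite K" for K :: "(nat \<times> bool) set"
    using that by (rule card_image_le)
  have "deg w = 1 \<or> 3 \<le> deg w" using deg_pos[OF w(1)] w(2) by linarith
  then show False
  proof
    assume "deg w = 1"
    then have "card (incident u) + card {w} \<le> 2 * card {u} + 2"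
      using u incident_subset incident_vertex fst_le[OF finite_incident[of u]]
      by (intro seven_ac_count) auto
    then show False using u by simp
  next
    assume "3 \<le> deg w"
    then obtain K where K: "K \<subseteq> incident w" "card K = 3" "finite K"
      by (rule obtain_subset_with_card_n)
    have disj: "incident u \<inter> K = {}" using K(1) incident_disjoint[of u w] \<open>w \<noteq> u\<close> by blast
    have card: "card (incident u \<union> K) = 7"
      using disj K u finite_incident by (simp add: card_Un_disjoint)
    have "card (incident u \<union> K) + card ({} :: 'a set) \<le> 2 * card {u, w} + 2"
    proof (rule seven_ac_count)
      show "incident u \<union> K \<subseteq> half_edges" using K incident_subset by blast
      show "(\<lambda>p. H p 0) ` (incident u \<union> K) \<subseteq> {u, w}" using K incident_vertex by blast
      show "card (fst ` (incident u \<union> K)) + card ({} :: 'a set) \<le> 7"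
        using fst_le[of "incident u \<union> K"] card K finite_incident by simp
    qed (use card in auto)
    then show False using card \<open>w \<noteq> u\<close> by simp
  qed
qed

text \<open>If all three vertices are trivalent, then both halves of the edges of \<open>p\<close> and of \<open>r\<close> are
  among the nine half-edges there, so that seven midpoints mark them.\<close>

lemma three_special_vertices:
  assumes deg: "deg u = 3" "deg w = 1 \<or> deg w = 3" "deg z = 1 \<or> deg z = 3"
    and ne: "u \<noteq> w" "u \<noteq> z" "w \<noteq> z"
    and p: "p \<in> half_edges" "H p 0 = u" "H (flip p) 0 = w"
    and r: "r \<in> half_edges" "H r 0 \<in> {u, w}" "H (flip r) 0 = z"
  shows False
proof -
  have fst_le: "card (fst ` K) \<le> card K" if "finite K" for K :: "(nat \<times> bool) set"
    using that by (rule card_image_le)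
  have sub: "incident a \<union> incident b \<subseteq> half_edges" for a b using incident_subset by blast
  have ver: "(\<lambda>p. H p 0) ` (incident a \<union> incident b) \<subseteq> {a, b}" for a b using incident_vertex by blast
  \<comment> \<open>Two trivalent vertices exhaust the bound: \<open>6 + 1 > 2 * 2 + 2\<close>, with
    at most seven marked points.\<close>
  have two: False if ab: "deg a = 3" "deg b = 3" "deg c = 1" "a \<noteq> b" for a b c
  proof -
    have card: "card (incident a \<union> incident b) = 6"
      using ab incident_disjoint[OF ab(4)] finite_incident by (simp add: card_Un_disjoint)
    then have "card (incident a \<union> incident b) + card {c} \<le> 2 * card {a, b} + 2"
      using sub ver ab(3) fst_le[of "incident a \<union> incident b"] finite_incident
      by (intro seven_ac_count) auto
    then show False using card ab(4) by simp
  qed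
  show False
  proof (cases "deg w = 1 \<and> deg z = 1")
    case True
    then have "card (incident u) + card {w, z} \<le> 2 * card {u} + 2"
      using deg(1) ne incident_subset incident_vertex fst_le[OF finite_incident[of u]]
      by (intro seven_ac_count) auto
    then show False using deg(1) ne by simp
  next
    case False
    then consider "deg w = 1" "deg z = 3" | "deg w = 3" "deg z = 1" | "deg w = 3" "deg z = 3"
      using deg by auto
    then show False
    proof cases
      case 1
      then show ?thesis using two[of u z w] deg ne by blast
    next
      case 2
      then show ?thesis using two[of u w z] deg ne by blast
    next
      case 3
      let ?K = "incident u \<union> incident w \<union> incident z"
      have "card (incident u \<union> incident w) = 6"
        using deg(1) 3 incident_disjoint[OF ne(1)] finite_incident by (simp add: card_Un_disjoint)
      moreover have "(incident u \<union> incident w) \<inter> incident z = {}"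
        using incident_disjoint[OF ne(2)] incident_disjoint[OF ne(3)] by blast
      ultimately have card: "card ?K = 9"
        using 3 finite_incident by (simp add: card_Un_disjoint)
      have "p \<in> ?K" "flip p \<in> ?K" "r \<in> ?K" "flip r \<in> ?K"
        using p r by (auto simp: incident_def)
      have "r \<noteq> p" "r \<noteq> flip p" using p r ne by auto
      then have "flip p \<noteq> flip r" "flip p \<noteq> r" "p \<noteq> r" "p \<noteq> flip r" by (metis flip_simps(3))+
      \<comment> \<open>Removing \<open>flip p\<close> and \<open>flip r\<close> loses no edge,
        since their partners \<open>p\<close> and \<open>r\<close> remain.\<close>
      have "fst ` ?K \<subseteq> fst ` (?K - {flip p, flip r})"
      proof
        fix i assume "i \<in> fst ` ?K"
        then obtain q where q: "q \<in> ?K" "i = fst q" by blast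
        show "i \<in> fst ` (?K - {flip p, flip r})"
        proof (cases "q = flip p \<or> q = flip r")
          case True
          moreover have "p \<in> ?K - {flip p, flip r}" "r \<in> ?K - {flip p, flip r}"
            using \<open>p \<in> ?K\<close> \<open>r \<in> ?K\<close> \<open>r \<noteq> flip p\<close> \<open>p \<noteq> flip r\<close> flip_simps(4) by (metis Diff_iff insertE singletonD)+
          ultimately show ?thesis using q(2) by force
        qed (use q in blast)
      qed
      then have "card (fst ` ?K) \<le> card (fst ` (?K - {flip p, flip r}))"
        using finite_incident by (intro card_mono) auto
      also have "\<dots> \<le> card (?K - {flip p, flip r})" using finite_incident by (intro fst_le) auto
      also have "\<dots> = card ?K - card {flip p, flip r}"
        using \<open>flip p \<in> ?K\<close> \<open>flip r \<in> ?K\<close> by (intro card_Diff_subset) auto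
      also have "\<dots> = 7" using card \<open>flip p \<noteq> flip r\<close> by simp
      finally have "card (fst ` ?K) + card ({} :: 'a set) \<le> 7" by simp
      then have "card ?K + card ({} :: 'a set) \<le> 2 * card {u, w, z} + 2"
        using card incident_subset incident_vertex by (intro seven_ac_count) (auto simp: incident_def)
      then show False using card ne by simp
    qed
  qed
qed

text \<open>With no second vertex, the four half-edges form two loops at \<open>u\<close>.\<close>

lemma deg_four_figure_eight:
  assumes u: "deg u = 4" and no2: "\<And>v. v \<in> vertices \<Longrightarrow> deg v \<noteq> 2"
  shows "is_figure_eight X"
proof -
  have at_u: "H q 0 = u" if "q \<in> half_edges" for q
    using deg_four_only[OF u] no2 that by blast
  then have "incident u = half_edges" by (auto simp: incident_def)
  then have "card I = 2" using u card_half_edges by simp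
  then obtain i j where ij: "I = {i, j}" "i \<noteq> j" by (auto simp: card_2_iff)
  let ?p = "(i, False)" and ?q = "(j, False)"
  have pq: "?p \<in> half_edges" "?q \<in> half_edges" using ij by auto
  have "H ?p 0 = u" "H (flip ?p) 0 = u" "H ?q 0 = u" "H (flip ?q) 0 = u"
    using at_u pq flip_in by blast+
  then have "simple_closed_curve_in X (g i ` {0..1})" "simple_closed_curve_in X (g j ` {0..1})"
    "g i ` {0..1} \<inter> g j ` {0..1} = {u}"
    using edge_is_loop[OF pq(1)] edge_is_loop[OF pq(2)] edges_meet[OF pq] ij by simp_all
  moreover have "topspace X = g i ` {0..1} \<union> g j ` {0..1}" using cover ij by simp
  ultimately show ?thesis using Hausdorff unfolding is_figure_eight_def by blast
qed

text \<open>Four half-edges make two edges. The edge of \<open>p\<close> uses the only half-edge at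
  \<open>w\<close>, so both ends of the other edge are at \<open>u\<close>.\<close>

lemma lollipop_case:
  assumes all: "half_edges = incident u \<union> incident w" and "u \<noteq> w" "deg u = 3" "deg w = 1"
    and p: "p \<in> half_edges" "H p 0 = u" "H (flip p) 0 = w"
  shows "is_lollipop X"
proof -
  have "card half_edges = 4"
    unfolding all using assms incident_disjoint[of u w] finite_incident by (simp add: card_Un_disjoint)
  then have I2: "card I = 2" using card_half_edges by simp
  have "fst p \<in> I" using p by auto
  then have "card (I - {fst p}) = 1" using I2 finite_I by simp
  then obtain j where j: "I - {fst p} = {j}" using card_1_singletonE by blast
  then have I: "I = {fst p, j}" "j \<noteq> fst p" using \<open>fst p \<in> I\<close> by auto
  let ?q = "(j, False)"
  have q: "?q \<in> half_edges" using I by auto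
  have "flip p \<in> incident w" using p by (simp add: incident_def)
  then have w: "incident w = {flip p}" using \<open>deg w = 1\<close> by (metis card_1_singletonE singletonD)
  have at_u: "H r 0 = u" if "r \<in> half_edges" "fst r = j" for r
  proof -
    have "r \<notin> incident w" using that I w by auto
    then have "r \<in> incident u" using that(1) all by blast
    then show ?thesis by (simp add: incident_def)
  qed
  have qu: "H ?q 0 = u" "H (flip ?q) 0 = u" using at_u[of ?q] at_u[of "flip ?q"] q by simp_all
  have "simple_closed_curve_in X (g j ` {0..1})" using edge_is_loop[OF q] qu by simp
  moreover have "arc_in_with_ends X (g (fst p) ` {0..1}) u w"
    using edge_is_arc[OF p(1)] p assms(2) by simp
  moreover have "topspace X = g j ` {0..1} \<union> g (fst p) ` {0..1}" using cover I by auto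
  moreover have "g j ` {0..1} \<inter> g (fst p) ` {0..1} = {u}"
    using edges_meet[OF q p(1)] I(2) qu p(2,3) by auto
  ultimately show ?thesis using Hausdorff unfolding is_lollipop_def by blast
qed

text \<open>Six half-edges make three edges, one of them that of \<open>p\<close>. The four ends of
  the other two are divided equally between \<open>u\<close> and \<open>w\<close>: either each edge
  is a loop, one at \<open>u\<close> and one at \<open>w\<close>, or both join \<open>u\<close> to
  \<open>w\<close>.\<close>

lemma dumbbell_or_theta_case:
  assumes all: "half_edges = incident u \<union> incident w" and uw: "u \<noteq> w" "deg u = 3" "deg w = 3"
    and p: "p \<in> half_edges" "H p 0 = u" "H (flip p) 0 = w"
  shows "is_dumbbell X \<or> is_theta_curve X"
proof -
  have "card half_edges = 6"
    unfolding all using assms incident_disjoint[of u w] finite_incident by (simp add: card_Un_disjoint)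
  then have I3: "card I = 3" using card_half_edges by simp
  have "fst p \<in> I" using p by auto
  then obtain j k where I: "I = {fst p, j, k}" "fst p \<noteq> j" "fst p \<noteq> k" "j \<noteq> k"
    using card_3_other_elements[OF finite_I I3] by metis
  let ?q = "(j, False)" and ?r = "(k, False)"
  have qr: "?q \<in> half_edges" "?r \<in> half_edges" using I by auto
  have at: "H s 0 = u \<or> H s 0 = w" if "s \<in> half_edges" for s
  proof -
    have "s \<in> incident u \<union> incident w" using that by (simp only: all)
    then show ?thesis by (auto simp: incident_def)
  qed
  have he: "half_edges = {p, flip p, ?q, flip ?q, ?r, flip ?r}"
    using p(1) I by (cases p) (auto simp: flip_def)
  have dist: "distinct [p, ?q, flip ?q, ?r, flip ?r]"
    using I(2-4) by (auto simp: flip_def)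
  have "incident u = {s \<in> {p, flip p, ?q, flip ?q, ?r, flip ?r}. H s 0 = u}"
    unfolding incident_def he ..
  also have "\<dots> = {p} \<union> ((if H ?q 0 = u then {?q} else {}) \<union> (if H (flip ?q) 0 = u then {flip ?q} else {})
      \<union> (if H ?r 0 = u then {?r} else {}) \<union> (if H (flip ?r) 0 = u then {flip ?r} else {}))"
    using p(2,3) uw(1) by auto
  finally have "card ({p} \<union> ((if H ?q 0 = u then {?q} else {}) \<union> (if H (flip ?q) 0 = u then {flip ?q} else {})
      \<union> (if H ?r 0 = u then {?r} else {}) \<union> (if H (flip ?r) 0 = u then {flip ?r} else {}))) = 3"
    using uw(2) by simp
  \<comment> \<open>Of the three half-edges at \<open>u\<close> one is \<open>p\<close>, and
    \<open>flip p\<close> starts at \<open>w\<close>; the other two belong to the edges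
    \<open>j\<close> and \<open>k\<close>.\<close>
  then have count: "of_bool (H ?q 0 = u) + of_bool (H (flip ?q) 0 = u) + of_bool (H ?r 0 = u)
      + of_bool (H (flip ?r) 0 = u) = (2::nat)"
    using dist
    by (cases "H ?q 0 = u"; cases "H (flip ?q) 0 = u"; cases "H ?r 0 = u"; cases "H (flip ?r) 0 = u")
      (auto simp: card_insert_if)
  have top: "topspace X = g (fst p) ` {0..1} \<union> g j ` {0..1} \<union> g k ` {0..1}"
    using cover I by auto
  have arc_p: "arc_in_with_ends X (g (fst p) ` {0..1}) u w"
    using edge_is_arc[OF p(1)] p uw by simp
  have meet: "g (fst p) ` {0..1} \<inter> g j ` {0..1} = {u, w} \<inter> {H ?q 0, H (flip ?q) 0}"
    "g (fst p) ` {0..1} \<inter> g k ` {0..1} = {u, w} \<inter> {H ?r 0, H (flip ?r) 0}"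
    "g j ` {0..1} \<inter> g k ` {0..1} = {H ?q 0, H (flip ?q) 0} \<inter> {H ?r 0, H (flip ?r) 0}"
    using edges_meet[OF p(1) qr(1)] edges_meet[OF p(1) qr(2)] edges_meet[OF qr] p(2,3) I(2-4) by simp_all
  have at_qr: "H ?q 0 = u \<or> H ?q 0 = w" "H (flip ?q) 0 = u \<or> H (flip ?q) 0 = w"
    "H ?r 0 = u \<or> H ?r 0 = w" "H (flip ?r) 0 = u \<or> H (flip ?r) 0 = w"
    using at qr flip_in by blast+
  consider (loops_qr) "H ?q 0 = u" "H (flip ?q) 0 = u" "H ?r 0 = w" "H (flip ?r) 0 = w"
    | (loops_rq) "H ?q 0 = w" "H (flip ?q) 0 = w" "H ?r 0 = u" "H (flip ?r) 0 = u"
    | (bridges) "H ?q 0 \<noteq> H (flip ?q) 0" "H ?r 0 \<noteq> H (flip ?r) 0"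
    using at_qr count uw(1)
    by (cases "H ?q 0 = u"; cases "H (flip ?q) 0 = u"; cases "H ?r 0 = u"; cases "H (flip ?r) 0 = u") simp_all
  then show ?thesis
  proof cases
    case loops_qr
    then have "simple_closed_curve_in X (g j ` {0..1})" "simple_closed_curve_in X (g k ` {0..1})"
      using edge_is_loop[OF qr(1)] edge_is_loop[OF qr(2)] by simp_all
    moreover have "topspace X = g j ` {0..1} \<union> g k ` {0..1} \<union> g (fst p) ` {0..1}"
      using top by blast
    moreover have "g j ` {0..1} \<inter> g k ` {0..1} = {}" "g j ` {0..1} \<inter> g (fst p) ` {0..1} = {u}"
      "g k ` {0..1} \<inter> g (fst p) ` {0..1} = {w}"
      using meet loops_qr uw(1) by (auto simp: Int_commute)
    ultimately have "is_dumbbell X" using Hausdorff arc_p unfolding is_dumbbell_def by blast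
    then show ?thesis ..
  next
    case loops_rq
    then have "simple_closed_curve_in X (g k ` {0..1})" "simple_closed_curve_in X (g j ` {0..1})"
      using edge_is_loop[OF qr(1)] edge_is_loop[OF qr(2)] by simp_all
    moreover have "topspace X = g k ` {0..1} \<union> g j ` {0..1} \<union> g (fst p) ` {0..1}"
      using top by blast
    moreover have "g k ` {0..1} \<inter> g j ` {0..1} = {}" "g k ` {0..1} \<inter> g (fst p) ` {0..1} = {u}"
      "g j ` {0..1} \<inter> g (fst p) ` {0..1} = {w}"
      using meet loops_rq uw(1) by (auto simp: Int_commute)
    ultimately have "is_dumbbell X" using Hausdorff arc_p unfolding is_dumbbell_def by blast
    then show ?thesis ..
  next
    case bridges
    have oriented: "arc_in_with_ends X (g (fst s) ` {0..1}) u w"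
      if s: "s \<in> half_edges" "H s 0 \<noteq> H (flip s) 0" for s
    proof -
      have "(H s 0 = u \<and> H (flip s) 0 = w) \<or> (H s 0 = w \<and> H (flip s) 0 = u)"
        using at[of s] at[of "flip s"] s by auto
      then show ?thesis
        using edge_is_arc[OF s] arc_in_with_ends_sym[OF Hausdorff edge_is_arc[OF s]] by auto
    qed
    have "arc_in_with_ends X (g j ` {0..1}) u w" "arc_in_with_ends X (g k ` {0..1}) u w"
      using oriented[OF qr(1) bridges(1)] oriented[OF qr(2) bridges(2)] by simp_all
    moreover have "{H ?q 0, H (flip ?q) 0} = {u, w}" "{H ?r 0, H (flip ?r) 0} = {u, w}"
      using at_qr bridges by auto
    then have "g (fst p) ` {0..1} \<inter> g j ` {0..1} = {u, w}" "g (fst p) ` {0..1} \<inter> g k ` {0..1} = {u, w}"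
      "g j ` {0..1} \<inter> g k ` {0..1} = {u, w}"
      using meet by simp_all
    ultimately have "is_theta_curve X"
      using Hausdorff arc_p top unfolding is_theta_curve_def by blast
    then show ?thesis ..
  qed
qed

text \<open>Once degrees 2 and 4 are settled, every degree is 1 or 3. A trivalent vertex then has
  exactly one other vertex beside it, whose degree decides between the lollipop and the last two
  graphs.\<close>

lemma classification:
  "is_arc X \<or> is_simple_closed_curve X \<or> is_figure_eight X \<or>
     is_lollipop X \<or> is_dumbbell X \<or> is_theta_curve X"
proof (cases "\<exists>v\<in>vertices. deg v = 2")
  case True
  then show ?thesis using deg_two_circle by blast
next
  case False
  then have no2: "\<And>v. v \<in> vertices \<Longrightarrow> deg v \<noteq> 2" by blast
  consider "\<And>v. v \<in> vertices \<Longrightarrow> deg v = 1" | u where "u \<in> vertices" "deg u \<noteq> 1" by blast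
  then show ?thesis
  proof cases
    case 1
    then show ?thesis using all_leaves_arc by blast
  next
    case (2 u)
    show ?thesis
    proof (cases "\<exists>v\<in>vertices. deg v = 4")
      case True
      then show ?thesis using deg_four_figure_eight no2 by blast
    next
      case no4: False
      have deg13: "deg v = 1 \<or> deg v = 3" if v: "v \<in> vertices" for v
      proof -
        have "deg v \<noteq> 4" using no4 v by blast
        then show ?thesis using deg_pos[OF v] deg_le_4[of v] no2[OF v] by linarith
      qed
      have u: "deg u = 3" using deg13[OF 2(1)] 2(2) by blast
      obtain p0 where p0: "p0 \<in> half_edges" "H p0 0 = u" using 2(1) by blast
      \<comment> \<open>Parity: if no edge left \<open>u\<close>, its three half-edges would be all
        half-edges, whose number is even.\<close>
      have "\<exists>p\<in>half_edges. H p 0 = u \<and> H (flip p) 0 \<noteq> u"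
      proof (rule ccontr)
        assume "\<not> ?thesis"
        then have "H q 0 \<in> {u}" if "q \<in> half_edges" for q
          using vertices_connected[OF p0(1), of "{u}" q] p0(2) that by blast
        then have "incident u = half_edges" by (auto simp: incident_def)
        then have "2 * card I = 3" using u card_half_edges by simp
        then show False by presburger
      qed
      then obtain p where p: "p \<in> half_edges" "H p 0 = u" "H (flip p) 0 \<noteq> u" by blast
      define w where "w = H (flip p) 0"
      have w: "w \<in> vertices" using p(1) unfolding w_def by (intro imageI) simp
      have uw: "u \<noteq> w" using p by (simp add: w_def)
      \<comment> \<open>An edge leaving \<open>{u, w}\<close> would reach a third vertex of degree 1
        or 3, joined to the other two as \<open>three_special_vertices\<close> requires.\<close>
      have step: "H (flip r) 0 \<in> {u, w}" if r: "r \<in> half_edges" "H r 0 \<in> {u, w}" for r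
      proof (rule ccontr)
        assume z: "H (flip r) 0 \<notin> {u, w}"
        have "H (flip r) 0 \<in> vertices" using r(1) by (intro imageI) simp
        then show False
          using three_special_vertices[OF u deg13[OF w] deg13 uw _ _ p(1,2) w_def[symmetric] r refl] z by blast
      qed
      have "H q 0 \<in> {u, w}" if "q \<in> half_edges" for q
        by (rule vertices_connected[OF p(1) _ step that]) (use p in simp)
      then have "half_edges = incident u \<union> incident w" by (auto simp: incident_def)
      then show ?thesis
        using lollipop_case[OF _ uw u _ p(1,2) w_def[symmetric]]
          dumbbell_or_theta_case[OF _ uw u _ p(1,2) w_def[symmetric]] deg13[OF w] by blast
    qed
  qed
qed

end

section \<open>Minimal presentations and the cycle of implications\<close>

lemma arc_family_reduced:
  assumes "arc_family X I g"
  obtains J f where "reduced_arc_family X J f"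
proof -
  define P where "P n \<longleftrightarrow> (\<exists>J f. arc_family X J f \<and> card J = n)" for n
  have "P (card I)" unfolding P_def by (intro exI conjI) (rule assms, rule refl)
  then have "P (LEAST n. P n)" by (rule LeastI)
  then obtain J f where J: "arc_family X J f" "card J = (LEAST n. P n)" unfolding P_def by blast
  have "card J \<le> card J'" if "arc_family X J' f'" for J' f'
    unfolding J(2) by (rule Least_le) (use that in \<open>auto simp: P_def\<close>)
  then have "reduced_arc_family X J f"
    using J(1) by (intro reduced_arc_family.intro reduced_arc_family_axioms.intro)
  then show thesis by (rule that)
qed

theorem theorem1p3:
  fixes G :: "'a topology"
  assumes "graph_space G"
  shows "(n_arc_connected 7 G \<longleftrightarrow> omega_arc_connected G) \<and>
         (omega_arc_connected G \<longleftrightarrow> injective_interval_image G) \<and>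
         (injective_interval_image G \<longleftrightarrow>
            is_arc G \<or> is_simple_closed_curve G \<or> is_figure_eight G \<or>
            is_lollipop G \<or> is_dumbbell G \<or> is_theta_curve G)"
proof -
  obtain I g where "arc_family G I g"
    using assms by (rule graph_space_arc_family)
  then obtain J f where J: "reduced_arc_family G J f" by (rule arc_family_reduced)
  then interpret reduced_arc_family G J f .
  have 1: "is_arc G \<or> is_simple_closed_curve G \<or> is_figure_eight G \<or>
      is_lollipop G \<or> is_dumbbell G \<or> is_theta_curve G" if "n_arc_connected 7 G"
  proof -
    interpret seven_ac_family G J f by unfold_locales (rule that)
    show ?thesis by (rule classification)
  qed
  have 2: "injective_interval_image G" if "is_arc G \<or> is_simple_closed_curve G \<or> is_figure_eight G \<or>
      is_lollipop G \<or> is_dumbbell G \<or> is_theta_curve G"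
    using that is_arc_injective_interval_image is_simple_closed_curve_injective_interval_image
      is_figure_eight_injective_interval_image is_lollipop_injective_interval_image
      is_dumbbell_injective_interval_image is_theta_curve_injective_interval_image by blast
  have 3: "omega_arc_connected G" if "injective_interval_image G"
    using injective_interval_image_omega_arc_connected[OF Hausdorff two_points that] .
  have 4: "n_arc_connected 7 G" if "omega_arc_connected G"
    using that by (simp add: omega_arc_connected_def)
  show ?thesis using 1 2 3 4 by blast
qed

end
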